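(* A positive-real function $Y(s)$ can be realized as the driving-point admittance of a one-port network, consisting of one damper, one inerter, and at most three springs, and satisfying the assumption that the associated three-port spring network $X$ has a well-defined admittance, if and only if $Y(s)$ can be written in the form $$Y(s)=\frac{\alpha_3 s^3+\alpha_2 s^2+\alpha_1 s+\alpha_0}{s^4+\beta_3 s^3+\beta_2 s^2+\beta_1 s},$$ where the coefficients satisfy $\alpha_0,\alpha_1,\alpha_2,\alpha_3,\beta_1,\beta_2,\beta_3\ge 0$, $W_1,W_2,W_3\ge 0$, $W^2=4W_1W_2W_3$, and also satisfy one of the following: 1. at least one of $\alpha_1$, $\alpha_2$, $\alpha_3$, $\beta_1$, $\beta_2$, $\beta_3$, $W_1$, $W_2$, $W_3$, $\beta_2-W/(2W_1)$, $\beta_3-W/(2W_2)$, $\alpha_3-W/(2W_3)$ is zero; or 2. Condition 1 is not satisfied, and one of the following holds: (a) $W<0$ and $\alpha_0=0$; (b) $W>0$ and $\alpha_0+\alpha_3\beta_1+\alpha_2\beta_2-\alpha_1\beta_3=0$; (c) $W>0$ and $\alpha_0+\alpha_3\beta_1+\alpha_1\beta_3-\alpha_2\beta_2=0$; (d) $W>0$ and $\alpha_0+\alpha_1\beta_3+\alpha_2\beta_2-\alpha_3\beta_1=0$.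
   Context: Notation: $W_1:=\alpha_3\beta_3-\alpha_2$, $W_2:=\alpha_3\beta_2-\alpha_1$, $W_3:=\beta_2\beta_3-\beta_1$, and $W:=\alpha_0+2\alpha_3\beta_2\beta_3-\alpha_3\beta_1-\alpha_2\beta_2-\alpha_1\beta_3$. (The last three quantities in Condition 1 are only considered when their denominators are nonzero; otherwise Condition 1 already holds.) Mechanical networks are built, without levers, from two-terminal elements whose force–velocity admittances (force/velocity in the Laplace variable $s$) are: spring $k/s$ with $k>0$, damper $c$ with $c>0$, inerter $bs$ with $b>0$. Force plays the role of current and velocity of voltage, and Kirchhoff's laws apply as for electrical networks. The driving-point admittance of a one-port network is the ratio of port force to port velocity. A real-rational function $Y(s)$ is positive-real if it is analytic with $\mathrm{Re}\,Y(s)\ge 0$ in $\mathrm{Re}\,s>0$. Given a one-port network with exactly one damper, one inerter and some springs, let $X$ be the three-port network consisting of the springs only, whose three ports are the driving port and the two pairs of nodes to which the damper and the inerter are attached; thus the one-port network is $X$ with two ports terminated by the damper and the inerter. The network $X$ has a well-defined admittance if its three port velocities can be prescribed independently and then determine the port forces uniquely, by a $3\times3$ admittance matrix. *)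

theory Defs
  imports
    "HOL-Analysis.Analysis"
    "HOL-Computational_Algebra.Computational_Algebra"
    "Graph_Theory.Digraph"
begin

section \<open>Real-rational functions and positive-realness\<close>

type_synonym ratfun = "real poly fract"

definition complex_poly :: "real poly \<Rightarrow> complex \<Rightarrow> complex" where
  "complex_poly p s = poly (map_poly of_real p) s"

text \<open>
  The quotient is taken in lowest terms, so that the denominator vanishes exactly at the poles of
  \<open>Y\<close>; \<open>p\<close> and \<open>q\<close> are unique up to a common constant. The value at a pole is conventionally \<open>0\<close>,
  but the absolute value of the quotient tends to infinity there, so analyticity still excludes
  poles in the open right half-plane.
\<close>
definition positive_real :: "ratfun \<Rightarrow> bool" where
  "positive_real Y \<longleftrightarrow>
     (\<exists>p q. q \<noteq> 0 \<and> coprime p q \<and> Y = Fract p q \<and>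
        (\<lambda>s. complex_poly p s / complex_poly q s) analytic_on {s. Re s > 0} \<and>
        (\<forall>s. Re s > 0 \<longrightarrow> Re (complex_poly p s / complex_poly q s) \<ge> 0))"


section \<open>Mechanical networks\<close>

datatype element = Spring real | Damper real | Inerter real

fun element_value :: "element \<Rightarrow> real" where
  "element_value (Spring k) = k"
| "element_value (Damper c) = c"
| "element_value (Inerter b) = b"

fun element_admittance :: "element \<Rightarrow> ratfun" where
  "element_admittance (Spring k) = Fract [:k:] [:0, 1:]"
| "element_admittance (Damper c) = Fract [:c:] 1"
| "element_admittance (Inerter b) = Fract [:0, b:] 1"

text \<open>
  Each arc of the multigraph carries one element; its orientation is only the reference direction
  for force and relative velocity. The graph need not be connected: an open circuit is a network
  with driving-point admittance \<open>0\<close>.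
\<close>
record ('a, 'b) mech_network =
  net_graph :: "('a, 'b) pre_digraph"
  element_of :: "'b \<Rightarrow> element"
  driving_port :: "'a \<times> 'a"

definition wf_network :: "('a, 'b) mech_network \<Rightarrow> bool" where
  "wf_network N \<longleftrightarrow>
     fin_digraph (net_graph N) \<and> loopfree_digraph (net_graph N) \<and>
     (\<forall>e \<in> arcs (net_graph N). element_value (element_of N e) > 0) \<and>
     fst (driving_port N) \<in> verts (net_graph N) \<and>
     snd (driving_port N) \<in> verts (net_graph N) \<and>
     fst (driving_port N) \<noteq> snd (driving_port N)"

definition springs :: "('a, 'b) mech_network \<Rightarrow> 'b set" where
  "springs N = {e \<in> arcs (net_graph N). \<exists>k. element_of N e = Spring k}"

definition dampers :: "('a, 'b) mech_network \<Rightarrow> 'b set" where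
  "dampers N = {e \<in> arcs (net_graph N). \<exists>c. element_of N e = Damper c}"

definition inerters :: "('a, 'b) mech_network \<Rightarrow> 'b set" where
  "inerters N = {e \<in> arcs (net_graph N). \<exists>b. element_of N e = Inerter b}"

text \<open>
  Port velocities \<open>V\<close> and port forces \<open>F\<close> are compatible with Kirchhoff's laws on a graph \<open>G\<close> whose
  arcs have admittances \<open>y\<close>. The velocity law is expressed by the node velocities \<open>v\<close>; in the force
  law, \<open>F $ p\<close> enters the network at the first node of port \<open>p\<close> and leaves it at the second.
\<close>
definition port_behaviour ::
  "('a, 'b) pre_digraph \<Rightarrow> ('b \<Rightarrow> ratfun) \<Rightarrow> ('p::finite \<Rightarrow> 'a \<times> 'a) \<Rightarrow> ratfun ^ 'p \<Rightarrow> ratfun ^ 'p \<Rightarrow> bool"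
where
  "port_behaviour G y P V F \<longleftrightarrow>
     (\<exists>v f.
        (\<forall>p. V $ p = v (fst (P p)) - v (snd (P p))) \<and>
        (\<forall>e \<in> arcs G. f e = y e * (v (tail G e) - v (head G e))) \<and>
        (\<forall>x \<in> verts G.
           (\<Sum>e \<in> out_arcs G x. f e) - (\<Sum>e \<in> in_arcs G x. f e) =
           (\<Sum>p \<in> UNIV. (if fst (P p) = x then F $ p else 0) - (if snd (P p) = x then F $ p else 0))))"

text \<open>
  The quantification over all \<open>V\<close> says that the port velocities can be prescribed independently; the
  equivalence says that the port forces then exist and are unique.
\<close>
definition has_admittance ::
  "('a, 'b) pre_digraph \<Rightarrow> ('b \<Rightarrow> ratfun) \<Rightarrow> ('p::finite \<Rightarrow> 'a \<times> 'a) \<Rightarrow> ratfun ^ 'p ^ 'p \<Rightarrow> bool"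
where
  "has_admittance G y P A \<longleftrightarrow> (\<forall>V F. port_behaviour G y P V F \<longleftrightarrow> F = A *v V)"

definition driving_point_admittance :: "('a, 'b) mech_network \<Rightarrow> ratfun \<Rightarrow> bool" where
  "driving_point_admittance N Y \<longleftrightarrow>
     has_admittance (net_graph N) (\<lambda>e. element_admittance (element_of N e))
       (\<lambda>_ :: 1. driving_port N) (mat Y)"

definition spring_graph :: "('a, 'b) mech_network \<Rightarrow> ('a, 'b) pre_digraph" where
  "spring_graph N = (net_graph N)\<lparr>arcs := springs N\<rparr>"

text \<open>
  The ports of the spring network \<open>X\<close> are the driving port, the nodes of the damper \<open>d\<close> and the nodes
  of the inerter \<open>i\<close>.
\<close>
definition X_ports :: "('a, 'b) mech_network \<Rightarrow> 'b \<Rightarrow> 'b \<Rightarrow> 3 \<Rightarrow> 'a \<times> 'a" where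
  "X_ports N d i p =
     (if p = 1 then driving_port N
      else if p = 2 then arc_to_ends (net_graph N) d
      else arc_to_ends (net_graph N) i)"

definition X_well_defined :: "('a, 'b) mech_network \<Rightarrow> 'b \<Rightarrow> 'b \<Rightarrow> bool" where
  "X_well_defined N d i \<longleftrightarrow>
     (\<exists>A. has_admittance (spring_graph N) (\<lambda>e. element_admittance (element_of N e))
            (X_ports N d i) A)"

end

theory Submission
  imports Defs
begin

no_notation fps_nth (infixl \<open>$\<close> 75)

text \<open>
  The spring network \<open>X\<close> has admittance \<open>L / s\<close> with a real symmetric \<open>3 \<times> 3\<close> matrix \<open>L\<close>, and closing
  two ports with a damper \<open>c\<close> and an inerter \<open>b\<close> makes \<open>s Y\<close> the quotient of
  \<open>det (L + diag (0, c s, b s\<^sup>2))\<close> by its principal minor for these two ports. With \<open>D = diag (1, c\<^sup>-\<^sup>1\<^sup>/\<^sup>2, b\<^sup>-\<^sup>1\<^sup>/\<^sup>2)\<close> and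
  \<open>R = D L D\<close>, the coefficients of \<open>Y\<close> are the principal minors of \<open>R\<close>, the numbers \<open>W\<^sub>1, W\<^sub>2, W\<^sub>3\<close>
  are the squares of its off-diagonal entries and \<open>W\<close> is twice their product. So the condition on the
  coefficients says that \<open>R\<close> has nonnegative principal minors and that an entry or a minor of order
  two vanishes, or one of four polynomial relations holds; all of this is invariant under
  \<open>R \<mapsto> D R D\<close> for diagonal \<open>D\<close>.

  Necessity: the ports of \<open>X\<close> form a forest, so the elongations of springs that are determined by the
  port velocities are given by a matrix \<open>M\<close> all of whose minors are \<open>-1\<close>, \<open>0\<close> or \<open>1\<close>, and
  \<open>L = M\<^sup>T K M\<close>. If there is one internal degree of freedom, eliminating it (star--mesh
  transformation) again gives this form; if there are more, \<open>L\<close> has rank at most one. The possible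
  \<open>M\<close> are few, and each yields one of the relations. Sufficiency: each relation allows a diagonal
  scaling after which \<open>R\<close> is the matrix of three springs on four nodes.
\<close>

section \<open>Shapes of spring matrices, Gram matrices and total unimodularity\<close>

section \<open>Matrices of three springs\<close>

definition det3 :: "(3 \<Rightarrow> 3 \<Rightarrow> real) \<Rightarrow> real" where
  "det3 G = G 1 1 * (G 2 2 * G 3 3 - G 2 3 * G 3 2) - G 1 2 * (G 2 1 * G 3 3 - G 2 3 * G 3 1)
    + G 1 3 * (G 2 1 * G 3 2 - G 2 2 * G 3 1)"

text \<open>The first two alternatives are Condition 1 in matrix form: \<open>q = r\<close> gives
  the principal minors of order two, \<open>q \<noteq> r\<close> the mixed ones. The other two are
  Condition 2. For symmetric \<open>G\<close> the last equation says
  \<open>det3 G = G a b * (G a c * G b c - G c c * G a b)\<close>, so only the choice of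
  \<open>c\<close> matters.\<close>

definition three_spring_shape :: "(3 \<Rightarrow> 3 \<Rightarrow> real) \<Rightarrow> bool" where
  "three_spring_shape G \<longleftrightarrow>
     (\<exists>p q. G p q = 0) \<or>
     (\<exists>p q r. q \<noteq> p \<and> r \<noteq> p \<and> G p p * G q r = G p q * G p r) \<or>
     G 1 2 * G 1 3 * G 2 3 < 0 \<and> det3 G = 0 \<or>
     G 1 2 * G 1 3 * G 2 3 > 0 \<and>
       (\<exists>a b c. distinct [a, b, c] \<and>
          G a a * G b b * G c c + G a b * G a c * G b c = G a a * (G b c)\<^sup>2 + G b b * (G a c)\<^sup>2)"

lemma three_spring_shape_zeroI: "G p q = 0 \<Longrightarrow> three_spring_shape G"
  unfolding three_spring_shape_def by (rule disjI1) (intro exI)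

lemma three_spring_shape_minorI: "q \<noteq> p \<Longrightarrow> r \<noteq> p \<Longrightarrow> G p p * G q r = G p q * G p r \<Longrightarrow> three_spring_shape G"
  unfolding three_spring_shape_def by (rule disjI2, rule disjI1) (intro exI conjI)

lemma three_spring_shape_negI: "G 1 2 * G 1 3 * G 2 3 < 0 \<Longrightarrow> det3 G = 0 \<Longrightarrow> three_spring_shape G"
  unfolding three_spring_shape_def by (rule disjI2, rule disjI2, rule disjI1) (intro conjI)

lemma three_spring_shape_posI:
  "G 1 2 * G 1 3 * G 2 3 > 0 \<Longrightarrow> distinct [a, b, c] \<Longrightarrow>
    G a a * G b b * G c c + G a b * G a c * G b c = G a a * (G b c)\<^sup>2 + G b b * (G a c)\<^sup>2 \<Longrightarrow> three_spring_shape G"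
  unfolding three_spring_shape_def by (rule disjI2, rule disjI2, rule disjI2) (intro exI conjI)

text \<open>Each equation is homogeneous in every index, so the scaling multiplies both sides by the
  same monomial; the product of the off-diagonal entries is multiplied by a nonzero square and keeps
  its sign.\<close>

lemma three_spring_shape_scale:
  assumes G: "three_spring_shape G" and d: "\<And>p. d p \<noteq> 0"
  shows "three_spring_shape (\<lambda>p q. d p * d q * G p q)"
proof -
  let ?H = "\<lambda>p q. d p * d q * G p q"
  have pr: "?H 1 2 * ?H 1 3 * ?H 2 3 = (d 1 * d 2 * d 3)\<^sup>2 * (G 1 2 * G 1 3 * G 2 3)"
    by (simp add: power2_eq_square)
  have sq: "(d 1 * d 2 * d 3)\<^sup>2 > 0" using d by simp
  from G[unfolded three_spring_shape_def] show ?thesis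
  proof (elim disjE exE conjE)
    fix p q assume "G p q = 0"
    then show ?thesis by (intro three_spring_shape_zeroI[of _ p q]) simp
  next
    fix p q r assume pqr: "q \<noteq> p" "r \<noteq> p" "G p p * G q r = G p q * G p r"
    have "?H p p * ?H q r = d p * d p * d q * d r * (G p p * G q r)" by simp
    also have "\<dots> = ?H p q * ?H p r" using pqr(3) by simp
    finally have "?H p p * ?H q r = ?H p q * ?H p r" .
    then show ?thesis by (rule three_spring_shape_minorI[of _ _ _ ?H, OF pqr(1,2)])
  next
    assume neg: "G 1 2 * G 1 3 * G 2 3 < 0" and 0: "det3 G = 0"
    have "det3 ?H = (d 1 * d 2 * d 3)\<^sup>2 * det3 G"
      unfolding det3_def by (simp add: algebra_simps power2_eq_square)
    then have "det3 ?H = 0" using 0 by simp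
    moreover have "?H 1 2 * ?H 1 3 * ?H 2 3 < 0"
      unfolding pr using sq neg by (rule mult_pos_neg)
    ultimately show ?thesis by (intro three_spring_shape_negI[of ?H])
  next
    fix a b c
    assume pos: "G 1 2 * G 1 3 * G 2 3 > 0" and abc: "distinct [a, b, c]"
      and eq: "G a a * G b b * G c c + G a b * G a c * G b c = G a a * (G b c)\<^sup>2 + G b b * (G a c)\<^sup>2"
    have "?H a a * ?H b b * ?H c c + ?H a b * ?H a c * ?H b c
        = (d a * d b * d c)\<^sup>2 * (G a a * G b b * G c c + G a b * G a c * G b c)"
      by (simp add: algebra_simps power2_eq_square)
    also have "\<dots> = ?H a a * (?H b c)\<^sup>2 + ?H b b * (?H a c)\<^sup>2"
      unfolding eq by (simp add: algebra_simps power2_eq_square)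
    finally have "?H a a * ?H b b * ?H c c + ?H a b * ?H a c * ?H b c
        = ?H a a * (?H b c)\<^sup>2 + ?H b b * (?H a c)\<^sup>2" .
    moreover have "?H 1 2 * ?H 1 3 * ?H 2 3 > 0"
      unfolding pr using sq pos by (rule mult_pos_pos)
    ultimately show ?thesis by (intro three_spring_shape_posI[of ?H, OF _ abc])
  qed
qed

text \<open>The matrix \<open>M^T K M\<close> with \<open>K = diag k\<close>. In the application,
  row \<open>j\<close> of \<open>M\<close> holds the elongations of spring \<open>j\<close> for unit
  velocities at the three ports.\<close>

definition gram :: "(nat \<Rightarrow> real) \<Rightarrow> (nat \<Rightarrow> 3 \<Rightarrow> real) \<Rightarrow> 3 \<Rightarrow> 3 \<Rightarrow> real" where
  "gram k M p q = (\<Sum>j<3. k j * M j p * M j q)"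

text \<open>Positive semidefiniteness, written through principal minors because these become the
  coefficients of \<open>Y\<close>.\<close>

definition nonneg_minors :: "(3 \<Rightarrow> 3 \<Rightarrow> real) \<Rightarrow> bool" where
  "nonneg_minors G \<longleftrightarrow> (\<forall>p q. G p q = G q p) \<and> (\<forall>p. 0 \<le> G p p) \<and>
     (\<forall>p q. (G p q)\<^sup>2 \<le> G p p * G q q) \<and> 0 \<le> det3 G"

lemma sum_lessThan_3: "(\<Sum>j<3. f j) = f 0 + f 1 + f (2::nat)"
  by (simp add: eval_nat_numeral)

definition minor3 :: "(nat \<Rightarrow> 3 \<Rightarrow> real) \<Rightarrow> nat \<Rightarrow> nat \<Rightarrow> nat \<Rightarrow> real" where
  "minor3 M i j k = M i 1 * (M j 2 * M k 3 - M j 3 * M k 2) - M i 2 * (M j 1 * M k 3 - M j 3 * M k 1)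
    + M i 3 * (M j 1 * M k 2 - M j 2 * M k 1)"

lemma det3_gram: "det3 (gram k M) = k 0 * k 1 * k 2 * (minor3 M 0 1 2)\<^sup>2"
  unfolding det3_def gram_def sum_lessThan_3 minor3_def by (simp add: algebra_simps power2_eq_square)

text \<open>Cauchy-Binet: the principal minors are sums of squared minors of \<open>M\<close> with
  nonnegative weights.\<close>

lemma nonneg_minors_gram:
  assumes k: "\<And>j. j < 3 \<Longrightarrow> 0 \<le> k j"
  shows "nonneg_minors (gram k M)"
proof -
  have k': "0 \<le> k 0" "0 \<le> k 1" "0 \<le> k 2" using k by auto
  have "0 \<le> gram k M p p" for p
    unfolding gram_def using k by (auto intro!: sum_nonneg simp: mult.assoc)
  moreover have "(gram k M p q)\<^sup>2 \<le> gram k M p p * gram k M q q" for p q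
  proof -
    have "gram k M p p * gram k M q q - (gram k M p q)\<^sup>2 =
        k 0 * k 1 * (M 0 p * M 1 q - M 1 p * M 0 q)\<^sup>2 +
        k 0 * k 2 * (M 0 p * M 2 q - M 2 p * M 0 q)\<^sup>2 +
        k 1 * k 2 * (M 1 p * M 2 q - M 2 p * M 1 q)\<^sup>2"
      unfolding gram_def sum_lessThan_3 by (simp add: algebra_simps power2_eq_square)
    also have "\<dots> \<ge> 0" using k' by simp
    finally show ?thesis by simp
  qed
  moreover have "0 \<le> det3 (gram k M)"
    unfolding det3_gram using k' by simp
  ultimately show ?thesis
    unfolding nonneg_minors_def by (auto simp: gram_def mult_ac)
qed

text \<open>Total unimodularity: the minors of every order are bounded. Indices may coincide or be
  unordered, which only adds zero minors and changes of sign.\<close>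

definition unimodular :: "(nat \<Rightarrow> 3 \<Rightarrow> real) \<Rightarrow> bool" where
  "unimodular M \<longleftrightarrow>
     (\<forall>i<3. \<forall>p. M i p \<in> {-1, 0, 1}) \<and>
     (\<forall>i<3. \<forall>j<3. \<forall>p q. M i p * M j q - M i q * M j p \<in> {-1, 0, 1}) \<and>
     (\<forall>i<3. \<forall>j<3. \<forall>k<3. minor3 M i j k \<in> {-1, 0, 1})"

lemma exists_3: "(\<exists>x::3. P x) \<longleftrightarrow> P 1 \<or> P 2 \<or> P 3"
  by (metis exhaust_3)

text \<open>The columns \<open>(x p, y p)\<close> are points of \<open>{0, 1}^2\<close>. Unless they
  are \<open>(0, 1)\<close>, \<open>(1, 0)\<close>, \<open>(1, 1)\<close> in some order, two of them
  coincide or one is adjacent to the two others along different axes, and a minor vanishes. The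
  exceptional triple satisfies the relation for a positive product.\<close>

lemma three_spring_shape_full_row:
  assumes k: "0 \<le> k i" "0 \<le> k j" "0 \<le> k l"
    and x: "\<And>p. x p \<in> {0, 1}" and y: "\<And>p. y p \<in> {0, 1}"
    and G: "G = (\<lambda>p q. k i + k j * x p * x q + k l * y p * (y q :: real))"
  shows "three_spring_shape G"
proof (cases "\<exists>p q. G p q = 0")
  case True
  then show ?thesis by (elim exE) (rule three_spring_shape_zeroI)
next
  case False
  have "0 \<le> G p q" for p q
    using x[of p] x[of q] y[of p] y[of q] k unfolding G by auto
  then have pos: "0 < G p q" for p q
    using False by (metis less_eq_real_def)
  then have pr: "G 1 2 * G 1 3 * G 2 3 > 0" by simp
  have xy: "x 1 = 0 \<or> x 1 = 1" "x 2 = 0 \<or> x 2 = 1" "x 3 = 0 \<or> x 3 = 1"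
    "y 1 = 0 \<or> y 1 = 1" "y 2 = 0 \<or> y 2 = 1" "y 3 = 0 \<or> y 3 = 1"
    using x y by blast+
  have "(\<exists>p q r. q \<noteq> p \<and> r \<noteq> p \<and> (x p - x q) * (x p - x r) = 0 \<and> (y p - y q) * (y p - y r) = 0 \<and>
         (x p * y q - y p * x q) * (x p * y r - y p * x r) = 0) \<or>
       (\<exists>a b c. distinct [a, b, c] \<and> x a = 0 \<and> y a = 1 \<and> x b = 1 \<and> y b = 0 \<and> x c = 1 \<and> y c = 1)"
    unfolding exists_3 using xy by (elim disjE) simp_all
  then show ?thesis
  proof (elim disjE exE conjE)
    fix p q r
    assume pqr: "q \<noteq> p" "r \<noteq> p" and 0: "(x p - x q) * (x p - x r) = 0" "(y p - y q) * (y p - y r) = 0"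
      "(x p * y q - y p * x q) * (x p * y r - y p * x r) = 0"
    \<comment> \<open>Cauchy-Binet for the rows \<open>1\<close>, \<open>x\<close>,
      \<open>y\<close>; the differences are minors that contain the row of ones.\<close>
    have "G p p * G q r - G p q * G p r = k i * k j * ((x p - x q) * (x p - x r)) +
        k i * k l * ((y p - y q) * (y p - y r)) +
        k j * k l * ((x p * y q - y p * x q) * (x p * y r - y p * x r))"
      unfolding G by (simp add: algebra_simps power2_eq_square)
    then have "G p p * G q r = G p q * G p r" unfolding 0 by simp
    then show ?thesis by (rule three_spring_shape_minorI[OF pqr])
  next
    fix a b c
    assume abc: "distinct [a, b, c]" and xy: "x a = 0" "y a = 1" "x b = 1" "y b = 0" "x c = 1" "y c = 1"
    have "G a a * G b b * G c c + G a b * G a c * G b c = G a a * (G b c)\<^sup>2 + G b b * (G a c)\<^sup>2"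
      unfolding G by (simp add: xy algebra_simps power2_eq_square)
    then show ?thesis by (rule three_spring_shape_posI[OF pr abc])
  qed
qed

text \<open>Two rows whose products in the columns \<open>p\<close>, \<open>q\<close> are
  \<open>1\<close> and \<open>-1\<close> have the minor \<open>2\<close> or \<open>-2\<close> in
  these columns, which unimodularity excludes.\<close>

lemma same_sign_overlap:
  assumes M: "unimodular M"
  obtains s :: real where "s = 1 \<or> s = - 1" "\<And>j. j < 3 \<Longrightarrow> M j p * M j q = 0 \<or> M j p * M j q = s"
proof -
  have ent: "M j r = -1 \<or> M j r = 0 \<or> M j r = 1" if "j < 3" for j r
    using M that unfolding unimodular_def by blast
  have False if ij: "i < 3" "j < 3" and "M i p * M i q = 1" "M j p * M j q = -1" for i j
  proof -
    have "M i p * M j q - M i q * M j p \<in> {-1, 0, 1}"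
      using M ij unfolding unimodular_def by blast
    then show False using that ent[OF ij(1), of p] ent[OF ij(1), of q] ent[OF ij(2), of p] ent[OF ij(2), of q]
      by auto
  qed
  moreover have "M j p * M j q = -1 \<or> M j p * M j q = 0 \<or> M j p * M j q = 1" if "j < 3" for j
    using ent[OF that, of p] ent[OF that, of q] by auto
  ultimately show ?thesis
    using that[of 1] that[of "-1"] by metis
qed

lemma nat_less_3_cases: "j < 3 \<longleftrightarrow> j = 0 \<or> j = 1 \<or> j = (2::nat)"
  by auto

text \<open>Without zero entries, any two columns have common support in some row. Either one row
  has full support, and dividing by its signs makes all entries \<open>0\<close> or
  \<open>1\<close>; or the three pairs of columns need three different rows, whose determinant is,
  up to sign, a sum of two signs and so must vanish.\<close>

lemma three_spring_shape_gram:
  assumes M: "unimodular M" and k: "\<And>j. j < 3 \<Longrightarrow> 0 \<le> k j"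
  shows "three_spring_shape (gram k M)"
proof (cases "\<exists>p q. gram k M p q = 0")
  case True
  then show ?thesis by (elim exE) (rule three_spring_shape_zeroI)
next
  case False
  have ent: "M j r = -1 \<or> M j r = 0 \<or> M j r = 1" if "j < 3" for j r
    using M that unfolding unimodular_def by blast
  have overlap: "\<exists>j<3. M j p * M j q \<noteq> 0" for p q
  proof (rule ccontr)
    assume "\<not> (\<exists>j<3. M j p * M j q \<noteq> 0)"
    then have "gram k M p q = 0" unfolding gram_def by (auto intro!: sum.neutral simp: mult.assoc)
    with False show False by blast
  qed
  show ?thesis
  proof (cases "\<exists>i<3. M i 1 \<noteq> 0 \<and> M i 2 \<noteq> 0 \<and> M i 3 \<noteq> 0")
    case True
    then obtain i where i: "i < 3" and nz: "M i 1 \<noteq> 0" "M i 2 \<noteq> 0" "M i 3 \<noteq> 0" by blast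
    have nz: "M i p \<noteq> 0" for p using nz exhaust_3[of p] by auto
    have e: "M i p = 1 \<or> M i p = -1" for p using ent[OF i, of p] nz[of p] by blast
    \<comment> \<open>Row \<open>i\<close> dictates the signs of the others: in such products
      \<open>M j p\<close> may be replaced by \<open>M i p * \<bar>M j p\<bar>\<close>.\<close>
    have prod: "M j p * M j q = M i p * M i q * (\<bar>M j p\<bar> * \<bar>M j q\<bar>)" if j: "j < 3" for j p q
    proof -
      obtain s where s: "s = 1 \<or> s = -1" "\<And>j. j < 3 \<Longrightarrow> M j p * M j q = 0 \<or> M j p * M j q = s"
        using same_sign_overlap[OF M] by metis
      have "M i p * M i q = s" using s(2)[OF i] nz[of p] nz[of q] by auto
      moreover have "M j p * M j q = s * (\<bar>M j p\<bar> * \<bar>M j q\<bar>)"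
        using s(2)[OF j] s(1) ent[OF j, of p] ent[OF j, of q] by (elim disjE) simp_all
      ultimately show ?thesis by simp
    qed
    obtain j l where jl: "j < 3" "l < 3" "{..<3} = {i, j, l}" "i \<noteq> j" "i \<noteq> l" "j \<noteq> l"
    proof -
      from i consider "i = 0" | "i = 1" | "i = 2" unfolding nat_less_3_cases by blast
      then show ?thesis
        by cases (rule that[of 1 2] that[of 0 2] that[of 0 1]; auto)+
    qed
    let ?G = "\<lambda>p q. k i + k j * \<bar>M j p\<bar> * \<bar>M j q\<bar> + k l * \<bar>M l p\<bar> * \<bar>M l q\<bar>"
    have abs: "\<bar>M j p\<bar> \<in> {0, 1}" if "j < 3" for j p
      using ent[OF that, of p] by auto
    have "three_spring_shape ?G"
      by (rule three_spring_shape_full_row[where i = i and j = j and l = l and k = k,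
            OF k[OF i] k[OF jl(1)] k[OF jl(2)] abs[OF jl(1)] abs[OF jl(2)] refl])
    then have "three_spring_shape (\<lambda>p q. M i p * M i q * ?G p q)"
      by (rule three_spring_shape_scale[where d = "M i"]) (rule nz)
    moreover have "gram k M p q = M i p * M i q * ?G p q" for p q
    proof -
      have "gram k M p q = k i * (M i p * M i q) + k j * (M j p * M j q) + k l * (M l p * M l q)"
        unfolding gram_def jl(3) using jl(4-6) by (simp add: mult.assoc)
      then show ?thesis unfolding prod[OF jl(1)] prod[OF jl(2)]
        by (simp add: algebra_simps)
    qed
    then have "gram k M = (\<lambda>p q. M i p * M i q * ?G p q)" by (intro ext)
    ultimately show ?thesis by simp
  next
    case no_full: False
    obtain h i j where h: "h < 3" "M h 1 \<noteq> 0" "M h 2 \<noteq> 0" and i: "i < 3" "M i 1 \<noteq> 0" "M i 3 \<noteq> 0"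
      and j: "j < 3" "M j 2 \<noteq> 0" "M j 3 \<noteq> 0"
      using overlap[of 1 2] overlap[of 1 3] overlap[of 2 3] unfolding mult_eq_0_iff by blast
    have z: "M h 3 = 0" "M i 2 = 0" "M j 1 = 0" using no_full h i j by blast+
    then have dist: "h \<noteq> i" "h \<noteq> j" "i \<noteq> j" using h i j by auto
    have G: "gram k M p q = k h * M h p * M h q + k i * M i p * M i q + k j * M j p * M j q" for p q
    proof -
      have "{..<3} = {h, i, j}" using dist h(1) i(1) j(1) by auto
      then show ?thesis unfolding gram_def using dist by simp
    qed
    have *: "M h p * M i q * M j r = 1 \<or> M h p * M i q * M j r = -1"
      if "h < 3" "M h p \<noteq> 0" "i < 3" "M i q \<noteq> 0" "j < 3" "M j r \<noteq> 0" for h i j p q r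
      using ent[OF that(1), of p] ent[OF that(3), of q] ent[OF that(5), of r] that(2,4,6)
      by (elim disjE) simp_all
    have det: "minor3 M h i j = - (M h 1 * M i 3 * M j 2 + M h 2 * M i 1 * M j 3)"
      unfolding minor3_def using z by simp
    moreover have "minor3 M h i j \<in> {-1, 0, 1}"
      using M h i j unfolding unimodular_def by blast
    \<comment> \<open>Both products are \<open>1\<close> or \<open>-1\<close>; equal ones would make
      the minor \<open>2\<close> or \<open>-2\<close>.\<close>
    ultimately have opp: "M h 1 * M i 3 * M j 2 = - (M h 2 * M i 1 * M j 3)"
      using *[OF h(1,2) i(1,3) j(1,2)] *[OF h(1,3) i(1,2) j(1,3)] by auto
    have "gram k M 1 2 * gram k M 1 3 * gram k M 2 3 =
        k h * k i * k j * ((M h 1 * M i 3 * M j 2) * (M h 2 * M i 1 * M j 3))"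
      unfolding G using z by simp
    also have "\<dots> = - (k h * k i * k j * (M h 2 * M i 1 * M j 3)\<^sup>2)"
      unfolding opp by (simp add: power2_eq_square)
    also have "\<dots> \<le> 0" using k h i j by simp
    finally have "gram k M 1 2 * gram k M 1 3 * gram k M 2 3 \<le> 0" .
    then have neg: "gram k M 1 2 * gram k M 1 3 * gram k M 2 3 < 0"
      using False by (simp add: less_le)
    have "det3 (gram k M) = k h * k i * k j * (M h 1 * M i 3 * M j 2 + M h 2 * M i 1 * M j 3)\<^sup>2"
      unfolding det3_def G using z by (simp add: algebra_simps power2_eq_square)
    then have "det3 (gram k M) = 0" unfolding opp by simp
    with neg show ?thesis by (rule three_spring_shape_negI)
  qed
qed

section \<open>Edges of a forest: dual node functions, exchange and bounds on minors\<close>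

section \<open>Elongations of independent edges\<close>

text \<open>Taken on node pairs rather than arcs, so that ports and springs are treated
  alike.\<close>

definition elong :: "('a \<Rightarrow> 'b::comm_ring) \<Rightarrow> 'a \<times> 'a \<Rightarrow> 'b" where
  "elong w e = w (fst e) - w (snd e)"

lemma elong_diff: "elong (\<lambda>x. v x - w x) e = elong v e - elong w e"
  and elong_scale: "elong (\<lambda>x. c * w x) e = c * elong w e"
  and elong_sum: "elong (\<lambda>x. \<Sum>i\<in>I. f i x) e = (\<Sum>i\<in>I. elong (f i) e)"
  by (simp_all add: elong_def algebra_simps sum_subtractf)

text \<open>A dual family of node functions exists exactly if the edges are linearly independent,
  that is, if they form a forest.\<close>

definition independent_edges :: "('i \<Rightarrow> 'a \<times> 'a) \<Rightarrow> bool" where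
  "independent_edges P \<longleftrightarrow>
     (\<forall>q. \<exists>w :: 'a \<Rightarrow> real. elong w (P q) = 1 \<and> (\<forall>r. r \<noteq> q \<longrightarrow> elong w (P r) = 0))"

text \<open>The edge \<open>h\<close> as a combination of basis edges; in a forest the coefficients
  are the signs along the path that joins the ends of \<open>h\<close>.\<close>

definition expands :: "('i::finite \<Rightarrow> 'a \<times> 'a) \<Rightarrow> ('i \<Rightarrow> real) \<Rightarrow> 'a \<times> 'a \<Rightarrow> bool" where
  "expands P m h \<longleftrightarrow> (\<forall>w. elong w h = (\<Sum>q\<in>UNIV. m q * elong w (P q)))"

lemma expands_dual:
  assumes "expands P m h" and "elong w (P q) = 1" "\<And>r. r \<noteq> q \<Longrightarrow> elong w (P r) = 0"
  shows "elong w h = m q"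
proof -
  have "elong w h = (\<Sum>r\<in>UNIV. m r * elong w (P r))" using assms(1) unfolding expands_def by blast
  also have "\<dots> = (\<Sum>r\<in>UNIV. if r = q then m q else 0)"
    by (rule sum.cong) (use assms in auto)
  finally show ?thesis by simp
qed

text \<open>
  If \<open>v\<close> is dual to the edge \<open>P q\<close>, so is the indicator of the level set of \<open>v\<close> through one end of
  \<open>P q\<close>, and it takes only the values \<open>0\<close> and \<open>1\<close>. Exchanging basis edges then gives the same bound
  for minors of higher order.
\<close>
lemma expands_coeff:
  assumes P: "independent_edges P" and m: "expands P m h"
  shows "m q \<in> {-1, 0, 1}"
proof -
  obtain w :: "_ \<Rightarrow> real" where w: "elong w (P q) = 1" "\<And>r. r \<noteq> q \<Longrightarrow> elong w (P r) = 0"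
    using P unfolding independent_edges_def by blast
  define u where "u x = (if w x = w (fst (P q)) then 1 else 0 :: real)" for x
  have "elong u (P q) = 1" "\<And>r. r \<noteq> q \<Longrightarrow> elong u (P r) = 0"
    using w unfolding elong_def u_def by force+
  then have "elong u h = m q" by (rule expands_dual[OF m])
  then show ?thesis unfolding elong_def u_def by (auto split: if_splits)
qed

text \<open>A functional that vanishes on the common kernel of finitely many others lies in their
  span; its coefficients are its values on a dual family.\<close>

lemma expands_exists:
  assumes P: "independent_edges P"
    and h: "\<And>w :: 'a \<Rightarrow> real. (\<And>q. elong w (P q) = 0) \<Longrightarrow> elong w h = 0"
  shows "\<exists>m. expands P m h"
proof -
  obtain W :: "_ \<Rightarrow> 'a \<Rightarrow> real"
    where W: "\<And>q. elong (W q) (P q) = 1" "\<And>q r. r \<noteq> q \<Longrightarrow> elong (W q) (P r) = 0"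
    using P unfolding independent_edges_def by metis
  have W': "elong (W q) (P r) = (if r = q then 1 else 0)" for q r
    using W by simp
  have "expands P (\<lambda>q. elong (W q) h) h"
    unfolding expands_def
  proof
    fix w :: "'a \<Rightarrow> real"
    \<comment> \<open>What is left of \<open>w\<close> after interpolating its elongations on
      \<open>P\<close> lies in the common kernel.\<close>
    define u where "u x = w x - (\<Sum>q\<in>UNIV. elong w (P q) * W q x)" for x
    have u: "elong u e = elong w e - (\<Sum>q\<in>UNIV. elong w (P q) * elong (W q) e)" for e
      unfolding u_def elong_diff elong_sum elong_scale ..
    have "elong u (P r) = 0" for r
      unfolding u W' by (simp add: if_distrib[of "(*) _"] cong: if_cong)
    then have "elong u h = 0" by (rule h)
    then show "elong w h = (\<Sum>q\<in>UNIV. elong (W q) h * elong w (P q))"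
      unfolding u by (simp add: mult.commute)
  qed
  then show ?thesis by blast
qed

text \<open>Steinitz exchange on the dual family: \<open>W q\<close> is divided by
  \<open>m q\<close>, and every other \<open>W r\<close> is corrected by a multiple of
  \<open>W q\<close> so as to vanish on \<open>h\<close>.\<close>

lemma independent_edges_exchange:
  fixes P :: "'i::finite \<Rightarrow> 'a \<times> 'a"
  assumes P: "independent_edges P" and m: "expands P m h" and q: "m q \<noteq> 0"
  shows "independent_edges (P(q := h))"
proof -
  obtain W :: "'i \<Rightarrow> 'a \<Rightarrow> real"
    where W: "\<And>q. elong (W q) (P q) = 1" "\<And>q r. r \<noteq> q \<Longrightarrow> elong (W q) (P r) = 0"
    using P unfolding independent_edges_def by metis
  have Wh: "elong (W r) h = m r" for r
    by (rule expands_dual[OF m W(1) W(2)])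
  show ?thesis
    unfolding independent_edges_def
  proof
    fix r
    show "\<exists>w::'a \<Rightarrow> real. elong w ((P(q := h)) r) = 1 \<and> (\<forall>s. s \<noteq> r \<longrightarrow> elong w ((P(q := h)) s) = 0)"
    proof (cases "r = q")
      case True
      show ?thesis
        by (rule exI[of _ "\<lambda>x. inverse (m q) * W q x"]) (use True q in \<open>auto simp: elong_scale W Wh\<close>)
    next
      case False
      define c where "c = m r / m q"
      have "c * m q = m r" unfolding c_def using q by simp
      then show ?thesis
        by (intro exI[of _ "\<lambda>x. W r x - c * W q x"])
          (use False in \<open>auto simp: elong_scale elong_diff W Wh\<close>)
    qed
  qed
qed

text \<open>Gaussian pivoting on \<open>m q\<close>: the expansion of \<open>h\<close> is solved for
  \<open>elong w (P q)\<close>, which is substituted into the expansion of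
  \<open>h'\<close>.\<close>

lemma expands_exchange:
  assumes m: "expands P m h" and m': "expands P m' h'" and q: "m q \<noteq> 0"
  shows "expands (P(q := h)) (\<lambda>r. if r = q then m' q / m q else m' r - m' q * m r / m q) h'"
  unfolding expands_def
proof
  fix w :: "_ \<Rightarrow> real"
  let ?c = "\<lambda>r. if r = q then m' q / m q else m' r - m' q * m r / m q"
  let ?R = "UNIV - {q}"
  have split: "(\<Sum>r\<in>UNIV. f r) = f q + (\<Sum>r\<in>?R. f r)" for f :: "_ \<Rightarrow> real"
    by (rule sum.remove) auto
  have "elong w h = m q * elong w (P q) + (\<Sum>r\<in>?R. m r * elong w (P r))"
    using m unfolding expands_def split by blast
  then have wq: "elong w (P q) = (elong w h - (\<Sum>r\<in>?R. m r * elong w (P r))) / m q"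
    using q by (simp add: field_simps)
  have "elong w h' = m' q * elong w (P q) + (\<Sum>r\<in>?R. m' r * elong w (P r))"
    using m' unfolding expands_def split by blast
  also have "\<dots> = m' q / m q * elong w h +
      ((\<Sum>r\<in>?R. m' r * elong w (P r)) - m' q / m q * (\<Sum>r\<in>?R. m r * elong w (P r)))"
    unfolding wq using q by (simp add: field_simps)
  also have "(\<Sum>r\<in>?R. m' r * elong w (P r)) - m' q / m q * (\<Sum>r\<in>?R. m r * elong w (P r)) =
      (\<Sum>r\<in>?R. ?c r * elong w ((P(q := h)) r))"
    unfolding sum_distrib_left sum_subtractf[symmetric]
    by (rule sum.cong) (auto simp: algebra_simps)
  finally show "elong w h' = (\<Sum>r\<in>UNIV. ?c r * elong w ((P(q := h)) r))"
    unfolding split by simp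
qed

text \<open>The minor is the pivot \<open>m q\<close> times a coefficient of \<open>h'\<close> after
  \<open>P q\<close> has been exchanged for \<open>h\<close>, and both factors are
  \<open>-1\<close>, \<open>0\<close> or \<open>1\<close>.\<close>

lemma expands_minor2:
  assumes P: "independent_edges P" and m: "expands P m h" and m': "expands P m' h'"
  shows "m q * m' r - m r * m' q \<in> {-1, 0, 1}"
proof -
  note c = expands_coeff[OF P m, of q] expands_coeff[OF P m, of r] expands_coeff[OF P m', of q]
  consider "q = r" | "q \<noteq> r" "m q = 0" | "q \<noteq> r" "m q \<noteq> 0" by blast
  then show ?thesis
  proof cases
    case 2
    then show ?thesis using c by auto
  next
    case 3
    have "m' r - m' q * m r / m q \<in> {-1, 0, 1}"
      using expands_coeff[OF independent_edges_exchange[where P = P, OF P m 3(2)] expands_exchange[OF m m' 3(2)], of r] 3(1)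
      by simp
    then have "m q * (m' r - m' q * m r / m q) \<in> {-1, 0, 1}"
      using c by auto
    moreover have "m q * (m' r - m' q * m r / m q) = m q * m' r - m r * m' q"
      using 3(2) by (simp add: field_simps)
    ultimately show ?thesis by simp
  qed simp
qed

text \<open>Schur complement of the pivot: the minor is \<open>m q\<close> times a minor of order
  two in the exchanged basis.\<close>

lemma expands_minor3:
  assumes P: "independent_edges P" and m: "expands P m h" and m': "expands P m' h'"
    and m'': "expands P m'' h''" and qrs: "r \<noteq> q" "s \<noteq> q" and q: "m q \<noteq> 0"
  shows "m q * (m' r * m'' s - m' s * m'' r) - m r * (m' q * m'' s - m' s * m'' q)
    + m s * (m' q * m'' r - m' r * m'' q) \<in> {-1, 0, 1}"
proof -
  have "(m' r - m' q * m r / m q) * (m'' s - m'' q * m s / m q) -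
      (m' s - m' q * m s / m q) * (m'' r - m'' q * m r / m q) \<in> {-1, 0, 1}" (is "?D \<in> _")
    using expands_minor2[OF independent_edges_exchange[where P = P, OF P m q] expands_exchange[OF m m' q]
        expands_exchange[OF m m'' q], of r s] qrs
    by simp
  then have "m q * ?D \<in> {-1, 0, 1}"
    using expands_coeff[OF P m, of q] by auto
  moreover have "m q * ?D = m q * (m' r * m'' s - m' s * m'' r) - m r * (m' q * m'' s - m' s * m'' q)
    + m s * (m' q * m'' r - m' r * m'' q)"
    using q by (simp add: field_simps)
  ultimately show ?thesis by simp
qed

text \<open>Any nonzero entry of the first row of a minor serves as pivot, since cyclic permutations
  of the columns preserve the determinant.\<close>

lemma unimodular_expands:
  assumes P: "independent_edges P" and M: "\<And>j. j < 3 \<Longrightarrow> expands P (M j) (E j)"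
  shows "unimodular M"
proof -
  have "minor3 M i j k \<in> {-1, 0, 1}" if "i < 3" "j < 3" "k < 3" for i j k
  proof -
    note D = expands_minor3[OF P M[OF that(1)] M[OF that(2)] M[OF that(3)]]
    consider "M i 1 \<noteq> 0" | "M i 2 \<noteq> 0" | "M i 3 \<noteq> 0" | "M i 1 = 0" "M i 2 = 0" "M i 3 = 0" by blast
    then show ?thesis
    proof cases
      case 1
      then show ?thesis using D[of 2 1 3] unfolding minor3_def by simp
    next
      case 2
      have "minor3 M i j k = M i 2 * (M j 3 * M k 1 - M j 1 * M k 3) - M i 3 * (M j 2 * M k 1 - M j 1 * M k 2)
          + M i 1 * (M j 2 * M k 3 - M j 3 * M k 2)"
        by (simp add: minor3_def algebra_simps)
      then show ?thesis using D[of 3 2 1] 2 by simp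
    next
      case 3
      have "minor3 M i j k = M i 3 * (M j 1 * M k 2 - M j 2 * M k 1) - M i 1 * (M j 3 * M k 2 - M j 2 * M k 3)
          + M i 2 * (M j 3 * M k 1 - M j 1 * M k 3)"
        by (simp add: minor3_def algebra_simps)
      then show ?thesis using D[of 1 3 2] 3 by simp
    next
      case 4
      then show ?thesis unfolding minor3_def by simp
    qed
  qed
  moreover have "M i p \<in> {-1, 0, 1}" if "i < 3" for i p
    by (rule expands_coeff[OF P M[OF that]])
  moreover have "M i p * M j q - M i q * M j p \<in> {-1, 0, 1}" if "i < 3" "j < 3" for i j p q
    by (rule expands_minor2[OF P M[OF that(1)] M[OF that(2)]])
  ultimately show ?thesis unfolding unimodular_def by blast
qed

section \<open>Elimination of internal degrees of freedom\<close>

text \<open>Star--mesh transformation: \<open>u\<close> minimizes the energy, and the mesh has conductances \<open>ki kj / S\<close> etc.\<close>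
lemma star_mesh:
  fixes a b u :: "3 \<Rightarrow> real"
  assumes S: "S = ki + kj * n\<^sup>2 + kl * n'\<^sup>2" "S \<noteq> 0"
    and u: "\<And>q. ki * u q + kj * (a q + n * u q) * n + kl * (b q + n' * u q) * n' = 0"
  shows "ki * u p * u q + kj * (a p + n * u p) * (a q + n * u q) + kl * (b p + n' * u p) * (b q + n' * u q) =
    ki * kj / S * a p * a q + ki * kl / S * b p * b q +
    kj * kl / S * (a p * n' - b p * n) * (a q * n' - b q * n)"
proof -
  \<comment> \<open>Stationarity reads \<open>S * u q = - c q\<close>, so multiplication by
    \<open>S\<close> allows \<open>u\<close> to be eliminated.\<close>
  define c where "c q = kj * n * a q + kl * n' * b q" for q
  have Su: "S * u q = - c q" for q
    using u[of q] unfolding S c_def by (simp add: algebra_simps power2_eq_square)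
  have "S * (ki * u p * u q + kj * (a p + n * u p) * (a q + n * u q) + kl * (b p + n' * u p) * (b q + n' * u q))
      = S * (kj * a p * a q + kl * b p * b q) + S * u p * c q + S * u q * c p + (S * u p) * (S * u q)"
    unfolding S c_def by (simp add: algebra_simps power2_eq_square)
  also have "\<dots> = S * (kj * a p * a q + kl * b p * b q) - c p * c q"
    unfolding Su by simp
  also have "\<dots> = ki * kj * a p * a q + ki * kl * b p * b q +
      kj * kl * (a p * n' - b p * n) * (a q * n' - b q * n)"
    unfolding S c_def by (simp add: algebra_simps power2_eq_square)
  finally have "ki * u p * u q + kj * (a p + n * u p) * (a q + n * u q) + kl * (b p + n' * u p) * (b q + n' * u q)
      = (ki * kj * a p * a q + ki * kl * b p * b q + kj * kl * (a p * n' - b p * n) * (a q * n' - b q * n)) / S"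
    using S(2) by (metis nonzero_mult_div_cancel_left)
  then show ?thesis by (simp add: add_divide_distrib)
qed

text \<open>The index \<open>None\<close> is the internal edge. The third row is
  \<open>m' None\<close> times the first minus \<open>m None\<close> times the second, so its minors
  with either are multiples of one minor of \<open>m\<close> and \<open>m'\<close>, and the
  determinant vanishes.\<close>

lemma unimodular_star_delta:
  assumes P: "independent_edges P" and m: "expands P m h" and m': "expands P m' h'"
  defines "M \<equiv> \<lambda>j q. if j = 0 then m (Some q) else if j = 1 then m' (Some q)
    else m (Some q) * m' None - m' (Some q) * m None"
  shows "unimodular M"
proof -
  note c = expands_coeff[OF P m] expands_coeff[OF P m']
  note d = expands_minor2[OF P m m']
  have g: "m (Some q) * m' None - m' (Some q) * m None \<in> {-1, 0, 1}" for q
    using d[of "Some q" None] by (simp add: mult.commute)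
  have d': "n * (m (Some p) * m' (Some q) - m (Some q) * m' (Some p)) \<in> {-1, 0, 1}"
    if "n \<in> {-1, 0, 1}" for n p q
    using d[of "Some p" "Some q"] that by auto
  have "M i p \<in> {-1, 0, 1}" for i p
    unfolding M_def using c[of "Some p"] g[of p] by simp
  moreover have "M i p * M j q - M i q * M j p \<in> {-1, 0, 1}" if "i < 3" "j < 3" for i j p q
  proof -
    have 01: "M 0 p * M 1 q - M 0 q * M 1 p \<in> {-1, 0, 1}" for p q
      unfolding M_def using d[of "Some p" "Some q"] by simp
    have 02: "M 0 p * M 2 q - M 0 q * M 2 p \<in> {-1, 0, 1}" for p q
    proof -
      have "M 0 p * M 2 q - M 0 q * M 2 p = - m None * (m (Some p) * m' (Some q) - m (Some q) * m' (Some p))"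
        unfolding M_def by (simp add: algebra_simps)
      also have "\<dots> \<in> {-1, 0, 1}" by (rule d') (use c(1)[of None] in auto)
      finally show ?thesis .
    qed
    have 12: "M 1 p * M 2 q - M 1 q * M 2 p \<in> {-1, 0, 1}" for p q
    proof -
      have "M 1 p * M 2 q - M 1 q * M 2 p = - m' None * (m (Some p) * m' (Some q) - m (Some q) * m' (Some p))"
        unfolding M_def by (simp add: algebra_simps)
      also have "\<dots> \<in> {-1, 0, 1}" by (rule d') (use c(2)[of None] in auto)
      finally show ?thesis .
    qed
    show ?thesis
      using that 01[of p q] 01[of q p] 02[of p q] 02[of q p] 12[of p q] 12[of q p]
      unfolding nat_less_3_cases by (elim disjE) (simp_all add: mult.commute)
  qed
  moreover have "minor3 M i j k \<in> {-1, 0, 1}" for i j k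
  proof -
    have "minor3 M i j k = 0"
      unfolding minor3_def M_def by (simp add: algebra_simps)
    then show ?thesis by simp
  qed
  ultimately show ?thesis unfolding unimodular_def by blast
qed

lemma sum_UNIV_option: "(\<Sum>q\<in>UNIV. f q) = f None + (\<Sum>q\<in>UNIV. f (Some q))"
  for f :: "'i::finite option \<Rightarrow> real"
  by (simp add: UNIV_option_conv sum.reindex)

text \<open>Testing the power balance with \<open>v p\<close> shows that \<open>L\<close> is the
  Gram matrix of the spring elongations. These are unimodular if the ports determine all springs.
  Otherwise a spring outside their span becomes a further basis edge: it is eliminated by the
  star-mesh transformation if the other two springs are then determined, and else \<open>L\<close>
  has rank at most one.\<close>

lemma spring_matrix_shape:
  fixes E :: "nat \<Rightarrow> 'a \<times> 'a" and P :: "3 \<Rightarrow> 'a \<times> 'a" and v :: "3 \<Rightarrow> 'a \<Rightarrow> real"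
  assumes k: "\<And>j. j < 3 \<Longrightarrow> 0 < k j"
    and v: "\<And>q r. elong (v q) (P r) = (if r = q then 1 else 0)"
    and eq: "\<And>w q. (\<Sum>j<3. k j * elong (v q) (E j) * elong w (E j)) = (\<Sum>p\<in>UNIV. L p q * elong w (P p))"
  shows "nonneg_minors L \<and> three_spring_shape L"
proof -
  define X where "X j q = elong (v q) (E j)" for j q
  have "L p q = gram k X p q" for p q
  proof -
    have "L p q = (\<Sum>r\<in>UNIV. L r q * elong (v p) (P r))"
      unfolding v by (simp add: if_distrib[of "(*) _"] cong: if_cong)
    also have "\<dots> = (\<Sum>j<3. k j * elong (v q) (E j) * elong (v p) (E j))"
      by (rule eq[symmetric])
    finally show ?thesis unfolding gram_def X_def by (simp add: mult_ac)
  qed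
  then have L: "L = gram k X" by (intro ext)
  have P: "independent_edges P"
    unfolding independent_edges_def by (auto intro!: exI[of _ "v _"] simp: v)
  have "three_spring_shape (gram k X)"
  proof (cases "\<forall>j<3. \<exists>m. expands P m (E j)")
    case True
    then obtain M where M: "\<And>j. j < 3 \<Longrightarrow> expands P (M j) (E j)" by metis
    have "X j q = M j q" if "j < 3" for j q
      unfolding X_def by (rule expands_dual[OF M[OF that]]) (simp_all add: v)
    then have "gram k X = gram k M"
      unfolding gram_def by (intro ext sum.cong) auto
    moreover have "three_spring_shape (gram k M)"
      by (rule three_spring_shape_gram[OF unimodular_expands[OF P M] less_imp_le[OF k]])
    ultimately show ?thesis by simp
  next
    case False
    then obtain i where i: "i < 3" and "\<not> (\<exists>m. expands P m (E i))" by blast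
    then obtain w :: "'a \<Rightarrow> real" where w: "\<And>q. elong w (P q) = 0" "elong w (E i) \<noteq> 0"
      using expands_exists[OF P, of "E i"] by blast
    \<comment> \<open>A motion that leaves all ports at rest and elongates spring \<open>i\<close>
      by one.\<close>
    define z where "z x = inverse (elong w (E i)) * w x" for x
    have z: "elong z (P q) = 0" "elong z (E i) = 1" for q
      unfolding z_def elong_scale using w by simp_all
    obtain j l where jl: "j < 3" "l < 3" "{..<3} = {i, j, l}" "i \<noteq> j" "i \<noteq> l" "j \<noteq> l"
    proof -
      from i consider "i = 0" | "i = 1" | "i = 2" unfolding nat_less_3_cases by blast
      then show ?thesis
        by cases (rule that[of 1 2] that[of 0 2] that[of 0 1]; auto)+
    qed
    have sum3: "(\<Sum>t<3. f t) = f i + f j + f l" for f :: "nat \<Rightarrow> real"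
      unfolding jl(3) using jl(4-6) by simp
    have G: "gram k X p q = k i * X i p * X i q + k j * X j p * X j q + k l * X l p * X l q" for p q
      unfolding gram_def sum3 ..
    \<comment> \<open>The power balance along motions that leave the ports at rest expresses
      internal equilibrium.\<close>
    have stat: "k i * X i q * elong w (E i) + k j * X j q * elong w (E j) + k l * X l q * elong w (E l) = 0"
      if "\<And>q. elong w (P q) = 0" for w q
      using eq[where w = w and q = q] unfolding sum3 that X_def by simp
    \<comment> \<open>Spring \<open>i\<close> joins the basis under the index
      \<open>None\<close>.\<close>
    define P' where "P' = case_option (E i) P"
    have P': "independent_edges P'"
      unfolding independent_edges_def
    proof
      fix q
      show "\<exists>w::'a \<Rightarrow> real. elong w (P' q) = 1 \<and> (\<forall>r. r \<noteq> q \<longrightarrow> elong w (P' r) = 0)"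
      proof (cases q)
        case None
        then show ?thesis
          unfolding P'_def by (intro exI[of _ z]) (auto simp: z split: option.split)
      next
        case (Some p)
        then show ?thesis
          unfolding P'_def
          by (intro exI[of _ "\<lambda>x. v p x - elong (v p) (E i) * z x"])
            (auto simp: elong_diff elong_scale z v split: option.split)
      qed
    qed
    \<comment> \<open>With two internal degrees of freedom, all spring elongations are proportional to one of them.\<close>
    have free: "three_spring_shape (gram k X)" if jl: "{..<3} = {i, j, l}" "i \<noteq> j" "i \<noteq> l" "j \<noteq> l"
      and no: "\<not> (\<exists>m. expands P' m (E j))" for j l
    proof -
      have jl3: "j < 3" "l < 3" using jl(1) by auto
      have sum3: "(\<Sum>t<3. f t) = f i + f j + f l" for f :: "nat \<Rightarrow> real"
        unfolding jl(1) using jl(2-4) by simp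
      have stat: "k i * X i q * elong w (E i) + k j * X j q * elong w (E j) + k l * X l q * elong w (E l) = 0"
        if "\<And>q. elong w (P q) = 0" for w q
        using eq[where w = w and q = q] unfolding sum3 that X_def by simp
      obtain y :: "'a \<Rightarrow> real" where y: "\<And>q. elong y (P' q) = 0" "elong y (E j) \<noteq> 0"
        using expands_exists[OF P', of "E j"] no by blast
      have yP: "elong y (P q) = 0" for q using y(1)[of "Some q"] unfolding P'_def by simp
      have yi: "elong y (E i) = 0" using y(1)[of None] unfolding P'_def by simp
      \<comment> \<open>Equilibrium along \<open>y\<close>, which moves neither the ports nor spring
        \<open>i\<close>, ties \<open>X j\<close> to \<open>X l\<close>; \<open>\<beta>\<close>
        arises likewise from \<open>z\<close>.\<close>
      define \<alpha> where "\<alpha> = - (k l * elong y (E l)) / (k j * elong y (E j))"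
      have kj: "k j \<noteq> 0" "k i \<noteq> 0" using k[OF jl3(1)] k[OF i] by auto
      have Xj: "X j q = \<alpha> * X l q" for q
      proof -
        have "k j * elong y (E j) * X j q = - (k l * elong y (E l)) * X l q"
          using stat[OF yP, of q] yi by (simp add: algebra_simps)
        then show ?thesis unfolding \<alpha>_def using y(2) kj by (simp add: field_simps)
      qed
      define \<beta> where "\<beta> = - (k j * elong z (E j) * \<alpha> + k l * elong z (E l)) / k i"
      have Xi: "X i q = \<beta> * X l q" for q
      proof -
        have "k i * X i q = - (k j * elong z (E j) * \<alpha> + k l * elong z (E l)) * X l q"
          using stat[OF z(1), of q] z(2) Xj[of q] by (simp add: algebra_simps)
        then show ?thesis unfolding \<beta>_def using kj by (simp add: field_simps)
      qed
      have "gram k X p q = (k i * \<beta>\<^sup>2 + k j * \<alpha>\<^sup>2 + k l) * (X l p * X l q)" for p q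
        unfolding gram_def sum3 Xi Xj by (simp add: algebra_simps power2_eq_square)
      then show ?thesis by (intro three_spring_shape_minorI[of 2 1 3]) simp_all
    qed
    show ?thesis
    proof (cases "(\<exists>m. expands P' m (E j)) \<and> (\<exists>m. expands P' m (E l))")
      case True
      then obtain m m' where m: "expands P' m (E j)" and m': "expands P' m' (E l)" by blast
      have Xe: "elong (v q) h = m (Some q) + m None * X i q" if "expands P' m h" for m h q
      proof -
        have "elong (v q) h = (\<Sum>r\<in>UNIV. m r * elong (v q) (P' r))"
          using that unfolding expands_def by blast
        also have "\<dots> = m None * elong (v q) (E i) + (\<Sum>r\<in>UNIV. m (Some r) * elong (v q) (P r))"
          unfolding sum_UNIV_option P'_def by simp
        also have "(\<Sum>r\<in>UNIV. m (Some r) * elong (v q) (P r)) = m (Some q)"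
          unfolding v by (simp add: if_distrib[of "(*) _"] cong: if_cong)
        finally show ?thesis unfolding X_def by simp
      qed
      have ze: "elong z h = m None" if "expands P' m h" for m h
        by (rule expands_dual[OF that]) (auto simp: P'_def z split: option.split)
      define S where "S = k i + k j * (m None)\<^sup>2 + k l * (m' None)\<^sup>2"
      have kp: "k i > 0" "k j > 0" "k l > 0" using k i jl by auto
      then have S: "S > 0" unfolding S_def by (simp add: add_pos_nonneg)
      define M where "M t q = (if t = 0 then m (Some q) else if t = 1 then m' (Some q)
        else m (Some q) * m' None - m' (Some q) * m None)" for t :: nat and q
      \<comment> \<open>The constants of the mesh that replaces the star.\<close>
      define \<kappa> where "\<kappa> t = (if t = 0 then k i * k j / S else if t = 1 then k i * k l / S else k j * k l / S)"
        for t :: nat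
      have "gram k X p q = gram \<kappa> M p q" for p q
      proof -
        have X: "X j q = m (Some q) + m None * X i q" "X l q = m' (Some q) + m' None * X i q" for q
          using Xe[OF m, of q] Xe[OF m', of q] unfolding X_def by simp_all
        have u: "k i * X i q + k j * (m (Some q) + m None * X i q) * m None
            + k l * (m' (Some q) + m' None * X i q) * m' None = 0" for q
          using stat[OF z(1), of q] unfolding ze[OF m] ze[OF m'] z(2) X by simp
        show ?thesis
          unfolding G X star_mesh[OF S_def less_imp_neq[OF S, symmetric], of "X i" "\<lambda>q. m (Some q)" "\<lambda>q. m' (Some q)", OF u]
          unfolding gram_def sum_lessThan_3 M_def \<kappa>_def by simp
      qed
      then have "gram k X = gram \<kappa> M" by (intro ext)
      moreover have "unimodular M"
        using unimodular_star_delta[OF P' m m'] unfolding M_def .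
      then have "three_spring_shape (gram \<kappa> M)"
        by (rule three_spring_shape_gram) (use kp S in \<open>auto simp: \<kappa>_def\<close>)
      ultimately show ?thesis by simp
    next
      case False
      moreover have "{..<3} = {i, l, j}" using jl(3) by auto
      ultimately show ?thesis
        using free[OF jl(3-6)] free[of l j] jl(4-6) by auto
    qed
  qed
  moreover have "nonneg_minors (gram k X)"
    by (rule nonneg_minors_gram[OF less_imp_le[OF k]])
  ultimately show ?thesis unfolding L by blast
qed

section \<open>Kirchhoff's laws in weak form and reduction of spring networks to real
  matrices\<close>

section \<open>Behaviour of networks over the rational functions\<close>

definition emb :: "real \<Rightarrow> ratfun" where "emb r = Fract [:r:] 1"

definition svar :: ratfun where "svar = Fract [:0, 1:] 1"

lemma emb_add: "emb (a + b) = emb a + emb b"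
  and emb_diff: "emb (a - b) = emb a - emb b"
  and emb_mult: "emb (a * b) = emb a * emb b"
  and emb_0 [simp]: "emb 0 = 0"
  and emb_1 [simp]: "emb 1 = 1"
  by (simp_all add: emb_def Zero_fract_def One_fract_def one_pCons mult.commute)

lemma emb_sum: "emb (sum f I) = (\<Sum>i\<in>I. emb (f i))"
  by (induction I rule: infinite_finite_induct) (simp_all add: emb_add)

lemma emb_if: "emb (if b then x else y) = (if b then emb x else emb y)"
  by simp

lemma svar_nonzero [simp]: "svar \<noteq> 0"
  by (simp add: svar_def Zero_fract_def eq_fract)

lemma elong_emb: "elong (\<lambda>x. emb (w x)) e = emb (elong w e)"
  by (simp add: elong_def emb_diff)

lemma Fract_pCons: "Fract (pCons a p) 1 = emb a + svar * Fract p 1"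
  by (simp add: emb_def svar_def)

lemma Fract_eq_divide: "Fract p q = Fract p 1 / Fract q 1"
  by simp

lemma element_admittance_emb:
  "element_admittance (Spring r) = emb r / svar"
  "element_admittance (Damper r) = emb r"
  "element_admittance (Inerter r) = emb r * svar"
  by (simp_all add: emb_def svar_def)

text \<open>Applied to node velocities, such a functional shows that a spring network can be solved over \<open>\<real>\<close>.\<close>
lemma coordinate_functional:
  obtains \<phi> :: "ratfun \<Rightarrow> real"
  where "\<And>x y. \<phi> (x + y) = \<phi> x + \<phi> y" "\<And>r x. \<phi> (emb r * x) = r * \<phi> x" "\<phi> 1 = 1"
proof -
  interpret vector_space_pair "\<lambda>r x. emb r * x" "(*) :: real \<Rightarrow> real \<Rightarrow> real"
    by unfold_locales (simp_all add: emb_add emb_mult algebra_simps)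
  have "vs1.independent {1}" by simp
  then obtain \<phi> where \<phi>: "Vector_Spaces.linear (\<lambda>r x. emb r * x) (*) \<phi>" "\<phi> 1 = 1"
    using linear_independent_extend[of "{1}" "\<lambda>_. 1"] by auto
  then show ?thesis
    using that[of \<phi>] linear_add[OF \<phi>(1)] linear_scale[OF \<phi>(1)] by blast
qed

text \<open>The force law tested with a node function \<open>w\<close>. The ring is left open
  because the law is needed over the reals and over \<open>ratfun\<close>.\<close>

definition virtual_power ::
  "('a, 'b) pre_digraph \<Rightarrow> ('b \<Rightarrow> 'k::comm_ring_1) \<Rightarrow> ('p::finite \<Rightarrow> 'a \<times> 'a) \<Rightarrow> ('a \<Rightarrow> 'k) \<Rightarrow> ('p \<Rightarrow> 'k) \<Rightarrow> ('a \<Rightarrow> 'k) \<Rightarrow> bool"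
where
  "virtual_power G y P v F w \<longleftrightarrow>
     (\<Sum>e\<in>arcs G. y e * elong v (arc_to_ends G e) * elong w (arc_to_ends G e)) =
     (\<Sum>p\<in>UNIV. F p * elong w (P p))"

locale ported_network = fin_digraph G for G :: "('a, 'b) pre_digraph" +
  fixes P :: "'p::finite \<Rightarrow> 'a \<times> 'a"
  assumes port_in_verts: "fst (P p) \<in> verts G" "snd (P p) \<in> verts G"
begin

text \<open>Summation by parts: each force enters the balances of two nodes with opposite signs, so
  the values of \<open>w\<close> combine to elongations.\<close>

lemma sum_balance:
  fixes w :: "'a \<Rightarrow> 'k::comm_ring_1"
  shows "(\<Sum>x\<in>verts G. w x * ((\<Sum>e\<in>out_arcs G x. f e) - (\<Sum>e\<in>in_arcs G x. f e) -
      (\<Sum>p\<in>UNIV. (if fst (P p) = x then F p else 0) - (if snd (P p) = x then F p else 0)))) =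
    (\<Sum>e\<in>arcs G. f e * elong w (arc_to_ends G e)) - (\<Sum>p\<in>UNIV. F p * elong w (P p))"
proof -
  have out: "(\<Sum>x\<in>verts G. w x * (\<Sum>e\<in>out_arcs G x. f e)) = (\<Sum>e\<in>arcs G. f e * w (tail G e))"
  proof -
    have "(\<Sum>x\<in>verts G. w x * (\<Sum>e\<in>out_arcs G x. f e)) =
        (\<Sum>x\<in>verts G. \<Sum>e\<in>{e \<in> arcs G. tail G e = x}. f e * w (tail G e))"
      unfolding out_arcs_def sum_distrib_left by (intro sum.cong) (auto simp: mult.commute)
    also have "\<dots> = (\<Sum>e\<in>arcs G. f e * w (tail G e))"
      by (rule sum.group) auto
    finally show ?thesis .
  qed
  have inn: "(\<Sum>x\<in>verts G. w x * (\<Sum>e\<in>in_arcs G x. f e)) = (\<Sum>e\<in>arcs G. f e * w (head G e))"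
  proof -
    have "(\<Sum>x\<in>verts G. w x * (\<Sum>e\<in>in_arcs G x. f e)) =
        (\<Sum>x\<in>verts G. \<Sum>e\<in>{e \<in> arcs G. head G e = x}. f e * w (head G e))"
      unfolding in_arcs_def sum_distrib_left by (intro sum.cong) (auto simp: mult.commute)
    also have "\<dots> = (\<Sum>e\<in>arcs G. f e * w (head G e))"
      by (rule sum.group) auto
    finally show ?thesis .
  qed
  have one: "(\<Sum>x\<in>verts G. w x * (if a = x then F p else 0)) = F p * w a" if "a \<in> verts G" for a p
    using that by (simp add: if_distrib[of "(*) _"] mult.commute cong: if_cong)
  have "(\<Sum>x\<in>verts G. w x * (\<Sum>p\<in>UNIV. (if fst (P p) = x then F p else 0) - (if snd (P p) = x then F p else 0)))
      = (\<Sum>p\<in>UNIV. \<Sum>x\<in>verts G. w x * (if fst (P p) = x then F p else 0) - w x * (if snd (P p) = x then F p else 0))"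
    unfolding sum_distrib_left right_diff_distrib by (rule sum.swap)
  also have "\<dots> = (\<Sum>p\<in>UNIV. F p * elong w (P p))"
    unfolding sum_subtractf one[OF port_in_verts(1)] one[OF port_in_verts(2)]
    by (simp add: elong_def right_diff_distrib sum_subtractf)
  finally have ports: "(\<Sum>x\<in>verts G. w x * (\<Sum>p\<in>UNIV. (if fst (P p) = x then F p else 0) - (if snd (P p) = x then F p else 0)))
      = (\<Sum>p\<in>UNIV. F p * elong w (P p))" .
  show ?thesis
    unfolding right_diff_distrib sum_subtractf[of _ _ "verts G"] ports[unfolded right_diff_distrib] out inn
    by (simp add: ports arc_to_ends_def elong_def right_diff_distrib sum_subtractf)
qed

text \<open>Indicator functions recover the balance at single nodes. They take only the values
  \<open>0\<close> and \<open>1\<close>, so the second equivalence carries real solutions over to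
  \<open>ratfun\<close>.\<close>

lemma balance_iff:
  fixes y :: "'b \<Rightarrow> 'k::comm_ring_1"
  defines "f \<equiv> \<lambda>v e. y e * elong v (arc_to_ends G e)"
  shows "(\<forall>x\<in>verts G. (\<Sum>e\<in>out_arcs G x. f v e) - (\<Sum>e\<in>in_arcs G x. f v e) =
      (\<Sum>p\<in>UNIV. (if fst (P p) = x then F p else 0) - (if snd (P p) = x then F p else 0)))
    \<longleftrightarrow> (\<forall>w. virtual_power G y P v F w)" (is "?bal \<longleftrightarrow> ?power")
    and "(\<forall>w. virtual_power G y P v F w) \<longleftrightarrow> (\<forall>x. virtual_power G y P v F (\<lambda>z. if z = x then 1 else 0))"
      (is "_ \<longleftrightarrow> ?indicators")
proof -
  let ?B = "\<lambda>x. (\<Sum>e\<in>out_arcs G x. f v e) - (\<Sum>e\<in>in_arcs G x. f v e) -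
      (\<Sum>p\<in>UNIV. (if fst (P p) = x then F p else 0) - (if snd (P p) = x then F p else 0))"
  have vp: "virtual_power G y P v F w \<longleftrightarrow> (\<Sum>x\<in>verts G. w x * ?B x) = 0" for w
    unfolding sum_balance virtual_power_def f_def by simp
  have 1: "?bal \<Longrightarrow> ?power" unfolding vp by simp
  have 2: "?indicators \<Longrightarrow> ?bal"
  proof
    fix x assume ind: ?indicators and x: "x \<in> verts G"
    have "(\<Sum>z\<in>verts G. (if z = x then 1 else 0) * ?B z) = (\<Sum>z\<in>verts G. if z = x then ?B x else 0)"
      by (rule sum.cong) auto
    also have "\<dots> = ?B x" using x by simp
    finally show "(\<Sum>e\<in>out_arcs G x. f v e) - (\<Sum>e\<in>in_arcs G x. f v e) =
      (\<Sum>p\<in>UNIV. (if fst (P p) = x then F p else 0) - (if snd (P p) = x then F p else 0))"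
      using ind[unfolded vp] by simp
  qed
  show "?bal \<longleftrightarrow> ?power" using 1 2 by blast
  show "?power \<longleftrightarrow> ?indicators" using 1 2 by blast
qed

text \<open>Arc forces are determined by the node velocities and drop out.\<close>

lemma port_behaviour_iff:
  "port_behaviour G y P V F \<longleftrightarrow>
     (\<exists>v. (\<forall>p. V $ p = elong v (P p)) \<and> (\<forall>w. virtual_power G y P v (($) F) w))"
proof -
  have "port_behaviour G y P V F \<longleftrightarrow>
     (\<exists>v. (\<forall>p. V $ p = elong v (P p)) \<and>
       (\<forall>x\<in>verts G. (\<Sum>e\<in>out_arcs G x. y e * elong v (arc_to_ends G e)) - (\<Sum>e\<in>in_arcs G x. y e * elong v (arc_to_ends G e)) =
      (\<Sum>p\<in>UNIV. (if fst (P p) = x then F $ p else 0) - (if snd (P p) = x then F $ p else 0))))"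
    (is "?L \<longleftrightarrow> ?R")
  proof
    assume ?L
    then obtain v f where v: "\<And>p. V $ p = v (fst (P p)) - v (snd (P p))"
      and f: "\<And>e. e \<in> arcs G \<Longrightarrow> f e = y e * (v (tail G e) - v (head G e))"
      and bal: "\<And>x. x \<in> verts G \<Longrightarrow> (\<Sum>e\<in>out_arcs G x. f e) - (\<Sum>e\<in>in_arcs G x. f e) =
        (\<Sum>p\<in>UNIV. (if fst (P p) = x then F $ p else 0) - (if snd (P p) = x then F $ p else 0))"
      unfolding port_behaviour_def by blast
    have f': "y e * elong v (arc_to_ends G e) = f e" if "e \<in> arcs G" for e
      using f[OF that] by (simp add: elong_def arc_to_ends_def)
    have "(\<Sum>e\<in>out_arcs G x. y e * elong v (arc_to_ends G e)) = (\<Sum>e\<in>out_arcs G x. f e)"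
      "(\<Sum>e\<in>in_arcs G x. y e * elong v (arc_to_ends G e)) = (\<Sum>e\<in>in_arcs G x. f e)" for x
      by (rule sum.cong; simp add: f')+
    then show ?R using v bal by (intro exI[of _ v]) (simp add: elong_def)
  next
    assume ?R
    then obtain v where "\<forall>p. V $ p = elong v (P p)"
      "\<forall>x\<in>verts G. (\<Sum>e\<in>out_arcs G x. y e * elong v (arc_to_ends G e)) - (\<Sum>e\<in>in_arcs G x. y e * elong v (arc_to_ends G e)) =
      (\<Sum>p\<in>UNIV. (if fst (P p) = x then F $ p else 0) - (if snd (P p) = x then F $ p else 0))"
      by blast
    then show ?L
      unfolding port_behaviour_def
      by (intro exI[of _ v] exI[of _ "\<lambda>e. y e * elong v (arc_to_ends G e)"])
        (simp add: elong_def arc_to_ends_def)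
  qed
  then show ?thesis unfolding balance_iff(1) .
qed

end

text \<open>After multiplication by \<open>s\<close> the equations have real coefficients. A
  coordinate functional therefore turns a solution for a unit port velocity into a real one, and
  uniqueness of the port forces identifies \<open>A\<close> with the matrix so obtained, divided by
  \<open>s\<close>.\<close>

lemma (in ported_network) spring_admittance_real:
  assumes A: "has_admittance G (\<lambda>e. emb (k e) / svar) P A"
  obtains L v where "\<And>p q. A $ p $ q = emb (L p q) / svar"
    and "\<And>q r. elong (v q) (P r) = (if r = q then 1 else 0 :: real)"
    and "\<And>w q. virtual_power G k P (v q) (\<lambda>p. L p q) w"
proof -
  obtain \<phi> where \<phi>: "\<And>x y. \<phi> (x + y) = \<phi> x + \<phi> y" "\<And>r x. \<phi> (emb r * x) = r * \<phi> x" "\<phi> 1 = 1"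
    using coordinate_functional by blast
  have \<phi>0: "\<phi> 0 = 0" using \<phi>(2)[of 0 0] by simp
  have \<phi>diff: "\<phi> (x - y) = \<phi> x - \<phi> y" for x y
    using \<phi>(1)[of "x - y" y] by simp
  have \<phi>sum: "\<phi> (sum f I) = (\<Sum>i\<in>I. \<phi> (f i))" for f :: "'c \<Rightarrow> ratfun" and I
    by (induction I rule: infinite_finite_induct) (simp_all add: \<phi> \<phi>0)
  \<comment> \<open>So far only one real coordinate of \<open>s A\<close>; the uniqueness argument
    below shows that \<open>s A\<close> is real and equals it.\<close>
  define L where "L p q = \<phi> (svar * A $ p $ q)" for p q
  have "\<exists>v. (\<forall>r. elong v (P r) = (if r = q then 1 else 0 :: real)) \<and>
      (\<forall>w. virtual_power G k P v (\<lambda>p. L p q) w)" for q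
  proof -
    have col: "(A *v axis q 1) $ p = A $ p $ q" for p
      by (simp add: matrix_vector_mult_def axis_def if_distrib[of "(*) _"] cong: if_cong)
    have "port_behaviour G (\<lambda>e. emb (k e) / svar) P (axis q 1) (A *v axis q 1)"
      using A unfolding has_admittance_def by blast
    then obtain v where v: "\<And>p. axis q 1 $ p = elong v (P p)"
      and power: "\<And>w. virtual_power G (\<lambda>e. emb (k e) / svar) P v (($) (A *v axis q 1)) w"
      unfolding port_behaviour_iff by blast
    let ?u = "\<lambda>x. \<phi> (v x)"
    have u: "elong ?u e = \<phi> (elong v e)" for e
      by (simp add: elong_def \<phi>diff)
    have "elong ?u (P r) = (if r = q then 1 else 0)" for r
      unfolding u v[symmetric] by (simp add: axis_def \<phi> \<phi>0)
    moreover have "virtual_power G k P ?u (\<lambda>p. L p q) w" for w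
    proof -
      have "svar * (\<Sum>e\<in>arcs G. emb (k e) / svar * elong v (arc_to_ends G e) * emb (elong w (arc_to_ends G e))) =
          svar * (\<Sum>p\<in>UNIV. A $ p $ q * emb (elong w (P p)))"
        using power[of "\<lambda>x. emb (w x)"] unfolding virtual_power_def elong_emb col by simp
      then have "(\<Sum>e\<in>arcs G. emb (k e * elong w (arc_to_ends G e)) * elong v (arc_to_ends G e)) =
          (\<Sum>p\<in>UNIV. emb (elong w (P p)) * (svar * A $ p $ q))"
        by (simp add: sum_distrib_left emb_mult mult_ac)
      then have "\<phi> (\<Sum>e\<in>arcs G. emb (k e * elong w (arc_to_ends G e)) * elong v (arc_to_ends G e)) =
          \<phi> (\<Sum>p\<in>UNIV. emb (elong w (P p)) * (svar * A $ p $ q))"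
        by simp
      then show ?thesis
        unfolding \<phi>sum \<phi>(2) virtual_power_def u L_def by (simp add: mult_ac)
    qed
    ultimately show ?thesis by blast
  qed
  then obtain v where v: "\<And>q r. elong (v q) (P r) = (if r = q then 1 else 0 :: real)"
    and power: "\<And>q w. virtual_power G k P (v q) (\<lambda>p. L p q) w"
    by metis
  have "A $ p $ q = emb (L p q) / svar" for p q
  proof -
    let ?F = "\<chi> p. emb (L p q) / svar"
    have "virtual_power G (\<lambda>e. emb (k e) / svar) P (\<lambda>x. emb (v q x)) (($) ?F) (\<lambda>z. if z = x then 1 else 0)" for x
    proof -
      let ?i = "\<lambda>z. if z = x then 1 else 0 :: real"
      have i: "(\<lambda>z. if z = x then 1 else 0) = (\<lambda>z. emb (?i z))" by auto
      have "emb (\<Sum>e\<in>arcs G. k e * elong (v q) (arc_to_ends G e) * elong ?i (arc_to_ends G e)) =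
          emb (\<Sum>p\<in>UNIV. L p q * elong ?i (P p))"
        using power[of q ?i] unfolding virtual_power_def by simp
      then have "(\<Sum>e\<in>arcs G. emb (k e) * elong (\<lambda>x. emb (v q x)) (arc_to_ends G e) * elong (\<lambda>z. emb (?i z)) (arc_to_ends G e)) / svar =
          (\<Sum>p\<in>UNIV. emb (L p q) * elong (\<lambda>z. emb (?i z)) (P p)) / svar"
        unfolding emb_sum emb_mult elong_emb by simp
      then show ?thesis
        unfolding virtual_power_def i by (simp add: sum_divide_distrib)
    qed
    then have "\<forall>w. virtual_power G (\<lambda>e. emb (k e) / svar) P (\<lambda>x. emb (v q x)) (($) ?F) w"
      unfolding balance_iff(2) by blast
    moreover have "axis q 1 $ r = elong (\<lambda>x. emb (v q x)) (P r)" for r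
      unfolding elong_emb v by (simp add: axis_def)
    ultimately have "port_behaviour G (\<lambda>e. emb (k e) / svar) P (axis q 1) ?F"
      unfolding port_behaviour_iff by blast
    then have "?F = A *v axis q 1"
      using A unfolding has_admittance_def by blast
    then have "?F $ p = (A *v axis q 1) $ p" by simp
    then show ?thesis
      by (simp add: matrix_vector_mult_def axis_def if_distrib[of "(*) _"] cong: if_cong)
  qed
  then show ?thesis using that v power by blast
qed

text \<open>Port 2 carries the damper and port 3 the inerter. For symmetric \<open>L\<close> the
  numerator is \<open>det (L + diag (0, c s, b s^2))\<close>, and the denominator is
  \<open>s\<close> times its minor for ports 2 and 3.\<close>

definition admittance_fun :: "(3 \<Rightarrow> 3 \<Rightarrow> real) \<Rightarrow> real \<Rightarrow> real \<Rightarrow> ratfun" where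
  "admittance_fun L c b =
     Fract [:det3 L, c * (L 1 1 * L 3 3 - (L 1 3)\<^sup>2), b * (L 1 1 * L 2 2 - (L 1 2)\<^sup>2), b * c * L 1 1:]
       [:0, L 2 2 * L 3 3 - (L 2 3)\<^sup>2, c * L 3 3, b * L 2 2, b * c:]"

text \<open>Numerator and denominator share the factor \<open>(d 2 * d 3)\<^sup>2\<close>. This lets
  the matrix absorb the damper and inerter constants, while \<open>d 1 = 1\<close> fixes the driving
  port.\<close>

lemma admittance_fun_scale:
  assumes d: "d 1 = 1" "d 2 \<noteq> 0" "d 3 \<noteq> 0"
  shows "admittance_fun (\<lambda>p q. d p * d q * R p q) ((d 2)\<^sup>2) ((d 3)\<^sup>2) = admittance_fun R 1 1"
proof -
  let ?t = "[:(d 2 * d 3)\<^sup>2:]"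
  have t: "?t \<noteq> 0" using d by simp
  show ?thesis
    unfolding admittance_fun_def
    by (subst mult_fract_cancel[OF t, symmetric], rule arg_cong2[of _ _ _ _ Fract])
      (simp_all add: d(1) det3_def algebra_simps power2_eq_square)
qed

text \<open>Cramer's rule for the two terminated ports; the minus signs are the reactions of damper
  and inerter, and \<open>D\<close> is the full determinant expanded along its first row.\<close>

lemma eliminate_two_ports:
  fixes f :: "'k::field"
  assumes s: "s \<noteq> 0" and \<Delta>: "\<Delta> = (l22 + c * s) * (l33 + b * s\<^sup>2) - l23\<^sup>2" "\<Delta> \<noteq> 0"
    and D: "D = l11 * \<Delta> - l12 * (l12 * (l33 + b * s\<^sup>2) - l13 * l23) - l13 * ((l22 + c * s) * l13 - l12 * l23)"
  shows "(\<exists>y z. s * f = l11 * x + l12 * y + l13 * z \<and>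
       s * (- c * y) = l12 * x + l22 * y + l23 * z \<and>
       s * (- (b * s) * z) = l13 * x + l23 * y + l33 * z) \<longleftrightarrow> f = D / (s * \<Delta>) * x"
    (is "?L \<longleftrightarrow> ?R")
proof
  assume ?L
  then obtain y z where 1: "s * f = l11 * x + l12 * y + l13 * z"
    and 2: "s * (- c * y) = l12 * x + l22 * y + l23 * z"
    and 3: "s * (- (b * s) * z) = l13 * x + l23 * y + l33 * z"
    by blast
  have 2: "(l22 + c * s) * y + l23 * z = - l12 * x"
    using arg_cong[OF 2, of "\<lambda>t. t - l12 * x + c * s * y"] by (simp add: algebra_simps)
  have 3: "l23 * y + (l33 + b * s\<^sup>2) * z = - l13 * x"
    using arg_cong[OF 3, of "\<lambda>t. t - l13 * x + b * s\<^sup>2 * z"] by (simp add: algebra_simps power2_eq_square)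
  have y: "\<Delta> * y = - (l12 * (l33 + b * s\<^sup>2) - l13 * l23) * x"
  proof -
    have "\<Delta> * y = (l33 + b * s\<^sup>2) * ((l22 + c * s) * y + l23 * z) - l23 * (l23 * y + (l33 + b * s\<^sup>2) * z)"
      unfolding \<Delta>(1) by (simp add: algebra_simps power2_eq_square)
    then show ?thesis unfolding 2 3 by (simp add: algebra_simps)
  qed
  have z: "\<Delta> * z = - ((l22 + c * s) * l13 - l12 * l23) * x"
  proof -
    have "\<Delta> * z = (l22 + c * s) * (l23 * y + (l33 + b * s\<^sup>2) * z) - l23 * ((l22 + c * s) * y + l23 * z)"
      unfolding \<Delta>(1) by (simp add: algebra_simps power2_eq_square)
    then show ?thesis unfolding 2 3 by (simp add: algebra_simps)
  qed
  have "\<Delta> * (s * f) = l11 * \<Delta> * x + l12 * (\<Delta> * y) + l13 * (\<Delta> * z)"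
    unfolding 1 by (simp add: algebra_simps)
  also have "\<dots> = D * x" unfolding y z D by (simp add: algebra_simps)
  finally show ?R using s \<Delta>(2) by (simp add: field_simps)
next
  assume ?R
  then have f: "s * f = D * x / \<Delta>" using s by simp
  define y where "y = - (l12 * (l33 + b * s\<^sup>2) - l13 * l23) * x / \<Delta>"
  define z where "z = - ((l22 + c * s) * l13 - l12 * l23) * x / \<Delta>"
  have y: "\<Delta> * y = - (l12 * (l33 + b * s\<^sup>2) - l13 * l23) * x" unfolding y_def using \<Delta>(2) by simp
  have z: "\<Delta> * z = - ((l22 + c * s) * l13 - l12 * l23) * x" unfolding z_def using \<Delta>(2) by simp
  have cancel: "a = b'" if "\<Delta> * a = \<Delta> * b'" for a b' using that \<Delta>(2) by simp
  have "\<Delta> * (s * f) = D * x" unfolding f using \<Delta>(2) by simp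
  also have "\<dots> = l11 * \<Delta> * x + l12 * (\<Delta> * y) + l13 * (\<Delta> * z)"
    unfolding y z D by (simp add: algebra_simps)
  finally have "\<Delta> * (s * f) = l11 * \<Delta> * x + l12 * (\<Delta> * y) + l13 * (\<Delta> * z)" .
  then have 1: "s * f = l11 * x + l12 * y + l13 * z"
    by - (rule cancel, simp add: algebra_simps)
  have "(l22 + c * s) * (\<Delta> * y) + l23 * (\<Delta> * z) = - l12 * \<Delta> * x"
    unfolding y z unfolding \<Delta>(1) by (simp add: algebra_simps power2_eq_square)
  then have 2: "(l22 + c * s) * y + l23 * z = - l12 * x"
    by - (rule cancel, simp add: algebra_simps)
  have "l23 * (\<Delta> * y) + (l33 + b * s\<^sup>2) * (\<Delta> * z) = - l13 * \<Delta> * x"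
    unfolding y z unfolding \<Delta>(1) by (simp add: algebra_simps power2_eq_square)
  then have 3: "l23 * y + (l33 + b * s\<^sup>2) * z = - l13 * x"
    by - (rule cancel, simp add: algebra_simps)
  have "s * (- c * y) = l12 * x + l22 * y + l23 * z"
    using arg_cong[OF 2, of "\<lambda>t. t + l12 * x - c * s * y"] by (simp add: algebra_simps)
  moreover have "s * (- (b * s) * z) = l13 * x + l23 * y + l33 * z"
    using arg_cong[OF 3, of "\<lambda>t. t + l13 * x - b * s\<^sup>2 * z"] by (simp add: algebra_simps power2_eq_square)
  ultimately show ?L using 1 by blast
qed

text \<open>\<open>\<Delta>\<close> is nonzero because its leading coefficient is
  \<open>b * c\<close>. The quotient is the one that eliminating two ports produces.\<close>

lemma admittance_fun_eq:
  fixes L :: "3 \<Rightarrow> 3 \<Rightarrow> real"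
  assumes c: "c > 0" and b: "b > 0" and sym: "\<And>p q. L p q = L q p"
  defines "\<Delta> \<equiv> (emb (L 2 2) + emb c * svar) * (emb (L 3 3) + emb b * svar\<^sup>2) - (emb (L 2 3))\<^sup>2"
  shows "\<Delta> \<noteq> 0"
    and "admittance_fun L c b = (emb (L 1 1) * \<Delta>
      - emb (L 1 2) * (emb (L 1 2) * (emb (L 3 3) + emb b * svar\<^sup>2) - emb (L 1 3) * emb (L 2 3))
      - emb (L 1 3) * ((emb (L 2 2) + emb c * svar) * emb (L 1 3) - emb (L 1 2) * emb (L 2 3))) / (svar * \<Delta>)"
proof -
  have emb_2: "emb 2 = 2" using emb_add[of 1 1] by simp
  have Fract_0: "Fract 0 1 = (0 :: ratfun)" by (simp add: Zero_fract_def)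
  note Fr = Fract_pCons Fract_0
  have \<Delta>: "\<Delta> = Fract [:L 2 2 * L 3 3 - (L 2 3)\<^sup>2, c * L 3 3, b * L 2 2, b * c:] 1"
    unfolding Fr \<Delta>_def
    by (simp add: emb_add emb_diff emb_mult algebra_simps power2_eq_square)
  show "\<Delta> \<noteq> 0"
    unfolding \<Delta> using c b by (simp add: Zero_fract_def eq_fract)
  have den: "svar * \<Delta> = Fract [:0, L 2 2 * L 3 3 - (L 2 3)\<^sup>2, c * L 3 3, b * L 2 2, b * c:] 1"
    unfolding \<Delta> by (subst (2) Fract_pCons) simp
  have num: "emb (L 1 1) * \<Delta>
      - emb (L 1 2) * (emb (L 1 2) * (emb (L 3 3) + emb b * svar\<^sup>2) - emb (L 1 3) * emb (L 2 3))
      - emb (L 1 3) * ((emb (L 2 2) + emb c * svar) * emb (L 1 3) - emb (L 1 2) * emb (L 2 3)) =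
    Fract [:det3 L, c * (L 1 1 * L 3 3 - (L 1 3)\<^sup>2), b * (L 1 1 * L 2 2 - (L 1 2)\<^sup>2), b * c * L 1 1:] 1"
    unfolding Fr \<Delta>_def det3_def sym[of 2 1] sym[of 3 1] sym[of 3 2]
    by (simp add: emb_2 emb_add emb_diff emb_mult algebra_simps power2_eq_square)
  show "admittance_fun L c b = (emb (L 1 1) * \<Delta>
      - emb (L 1 2) * (emb (L 1 2) * (emb (L 3 3) + emb b * svar\<^sup>2) - emb (L 1 3) * emb (L 2 3))
      - emb (L 1 3) * ((emb (L 2 2) + emb c * svar) * emb (L 1 3) - emb (L 1 2) * emb (L 2 3))) / (svar * \<Delta>)"
    unfolding num den admittance_fun_def by (rule Fract_eq_divide)
qed

lemma vec_lambda_nth: "($) (vec_lambda f) = f"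
  by (intro ext) simp

text \<open>Damper and inerter are removed from the arcs and return as port forces of
  \<open>X\<close> with reversed sign. The one-port behaves as \<open>X\<close> with these forces
  tied to the port velocities, and the two ports are then eliminated.\<close>

lemma driving_point_admittance_iff:
  assumes wf: "wf_network N" and d: "dampers N = {d}" and i: "inerters N = {i}"
    and el: "element_of N d = Damper c" "element_of N i = Inerter b"
    and A: "has_admittance (spring_graph N) (\<lambda>e. element_admittance (element_of N e)) (X_ports N d i) A"
    and L: "\<And>p q. A $ p $ q = emb (L p q) / svar" and sym: "\<And>p q. L p q = L q p"
  shows "driving_point_admittance N Y \<longleftrightarrow> Y = admittance_fun L c b"
proof -
  let ?G = "net_graph N" and ?y = "\<lambda>e. element_admittance (element_of N e)"
  interpret G: fin_digraph ?G using wf unfolding wf_network_def by blast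
  have di: "d \<in> arcs ?G" "i \<in> arcs ?G" using d i unfolding dampers_def inerters_def by blast+
  have cb: "c > 0" "b > 0"
    using wf di el unfolding wf_network_def by (metis element_value.simps)+
  have arcs: "arcs ?G = insert d (insert i (springs N))"
  proof -
    have "e \<in> springs N \<union> dampers N \<union> inerters N" if "e \<in> arcs ?G" for e
      using that by (cases "element_of N e") (auto simp: springs_def dampers_def inerters_def)
    then show ?thesis using d i di unfolding springs_def by auto
  qed
  have fresh: "d \<notin> insert i (springs N)" "i \<notin> springs N"
    using el unfolding springs_def by auto
  have fin: "finite (springs N)" unfolding springs_def by simp
  interpret S: fin_digraph "spring_graph N"
    by unfold_locales (auto simp: spring_graph_def springs_def)
  interpret X: ported_network "spring_graph N" "X_ports N d i"
    using wf di by unfold_locales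
      (auto simp: X_ports_def spring_graph_def wf_network_def arc_to_ends_def)
  interpret D: ported_network ?G "\<lambda>_ :: 1. driving_port N"
    using wf by unfold_locales (auto simp: wf_network_def)
  have power: "virtual_power ?G ?y (\<lambda>_ :: 1. driving_port N) v (($) F) w \<longleftrightarrow>
      virtual_power (spring_graph N) ?y (X_ports N d i) v
        (\<lambda>p. if p = 1 then F $ 1 else if p = 2 then - emb c * elong v (arc_to_ends ?G d)
          else - (emb b * svar) * elong v (arc_to_ends ?G i)) w" for v w F
  proof -
    have ends: "arc_to_ends (spring_graph N) e = arc_to_ends ?G e" for e
      by (simp add: spring_graph_def arc_to_ends_def)
    have sp: "arcs (spring_graph N) = springs N" by (simp add: spring_graph_def)
    let ?e = "\<lambda>u e. elong u (arc_to_ends ?G e)"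
    have sum: "(\<Sum>e\<in>insert d (insert i (springs N)). ?y e * ?e v e * ?e w e) =
        emb c * ?e v d * ?e w d + (emb b * svar * ?e v i * ?e w i + (\<Sum>e\<in>springs N. ?y e * ?e v e * ?e w e))"
      unfolding sum.insert[OF finite.insertI[OF fin] fresh(1)] sum.insert[OF fin fresh(2)] el element_admittance_emb ..
    have move: "a + (b' + S) = f \<longleftrightarrow> S = f + - a + - b'" for a b' S f :: ratfun
    proof
      assume "a + (b' + S) = f"
      from this[symmetric] show "S = f + - a + - b'" by simp
    qed simp
    have ports: "X_ports N d i 1 = driving_port N" "X_ports N d i 2 = arc_to_ends ?G d"
      "X_ports N d i 3 = arc_to_ends ?G i"
      by (simp_all add: X_ports_def)
    have neq: "(2::3) \<noteq> 1" "(3::3) \<noteq> 1" "(3::3) \<noteq> 2" by simp_all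
    show ?thesis
      unfolding virtual_power_def arcs sp sum_1 sum_3 ends sum move ports
      by (simp only: neq if_True if_False refl mult_minus_left)
  qed
  have X: "port_behaviour (spring_graph N) ?y (X_ports N d i) V F \<longleftrightarrow> F = A *v V" for V F
    using A unfolding has_admittance_def by blast
  have beh: "port_behaviour ?G ?y (\<lambda>_ :: 1. driving_port N) V F \<longleftrightarrow> F $ 1 = admittance_fun L c b * V $ 1" for V F
  proof -
    have "port_behaviour ?G ?y (\<lambda>_ :: 1. driving_port N) V F \<longleftrightarrow>
       (\<exists>y z. port_behaviour (spring_graph N) ?y (X_ports N d i)
         (\<chi> p. if p = 1 then V $ 1 else if p = 2 then y else z)
         (\<chi> p. if p = 1 then F $ 1 else if p = 2 then - emb c * y else - (emb b * svar) * z))"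
      (is "?L \<longleftrightarrow> ?R")
    proof
      assume ?L
      then obtain v where v: "V $ 1 = elong v (driving_port N)"
        and w: "\<And>w. virtual_power ?G ?y (\<lambda>_ :: 1. driving_port N) v (($) F) w"
        unfolding D.port_behaviour_iff by auto
      have "(if p = 1 then V $ 1 else if p = 2 then elong v (arc_to_ends ?G d) else elong v (arc_to_ends ?G i)) =
          elong v (X_ports N d i p)" for p
        unfolding X_ports_def v by simp
      then show ?R
        unfolding X.port_behaviour_iff vec_lambda_nth vec_lambda_beta using w[unfolded power] by blast
    next
      assume ?R
      then obtain y z v where v: "\<And>p. (if p = 1 then V $ 1 else if p = 2 then y else z) = elong v (X_ports N d i p)"
        and w: "\<And>w. virtual_power (spring_graph N) ?y (X_ports N d i) v
          (\<lambda>p. if p = 1 then F $ 1 else if p = 2 then - emb c * y else - (emb b * svar) * z) w"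
        unfolding X.port_behaviour_iff vec_lambda_nth vec_lambda_beta by blast
      have V: "V $ 1 = elong v (driving_port N)" "y = elong v (arc_to_ends ?G d)" "z = elong v (arc_to_ends ?G i)"
        using v[of 1] v[of 2] v[of 3] by (simp_all add: X_ports_def)
      have "V $ p = elong v (driving_port N)" for p
        using V(1) by (metis num1_eq1)
      then show ?L
        unfolding D.port_behaviour_iff power using w[unfolded V(2,3)] by blast
    qed
    also have "\<dots> \<longleftrightarrow> (\<exists>y z. (\<chi> p. if p = 1 then F $ 1 else if p = 2 then - emb c * y else - (emb b * svar) * z) =
        A *v (\<chi> p. if p = 1 then V $ 1 else if p = 2 then y else z))"
      unfolding X ..
    also have "\<dots> \<longleftrightarrow> (\<exists>y z. svar * F $ 1 = emb (L 1 1) * V $ 1 + emb (L 1 2) * y + emb (L 1 3) * z \<and>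
       svar * (- emb c * y) = emb (L 1 2) * V $ 1 + emb (L 2 2) * y + emb (L 2 3) * z \<and>
       svar * (- (emb b * svar) * z) = emb (L 1 3) * V $ 1 + emb (L 2 3) * y + emb (L 3 3) * z)"
    proof -
      have div: "f = l / svar * x + l' / svar * y + l'' / svar * z \<longleftrightarrow> svar * f = l * x + l' * y + l'' * z"
        for f l l' l'' x y z :: ratfun
      proof -
        have *: "l / svar * x + l' / svar * y + l'' / svar * z = (l * x + l' * y + l'' * z) / svar"
          by (simp add: add_divide_distrib)
        show ?thesis unfolding * nonzero_eq_divide_eq[OF svar_nonzero] mult.commute[of svar f] ..
      qed
      have neq: "((2::3) = 1) = False" "((3::3) = 1) = False" "((3::3) = 2) = False" by simp_all
      show ?thesis
        unfolding vec_eq_iff forall_3 matrix_vector_mult_def vec_lambda_beta sum_3 L div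
          neq simp_thms(6) if_True if_False sym[of 2 1] sym[of 3 1] sym[of 3 2] ..
    qed
    also have "\<dots> \<longleftrightarrow> F $ 1 = admittance_fun L c b * V $ 1"
      unfolding admittance_fun_eq(2)[OF cb sym]
      by (rule eliminate_two_ports[where s = svar and c = "emb c" and b = "emb b" and f = "F $ 1" and x = "V $ 1"
            and ?l11.0 = "emb (L 1 1)" and ?l12.0 = "emb (L 1 2)" and ?l13.0 = "emb (L 1 3)"
            and ?l22.0 = "emb (L 2 2)" and ?l23.0 = "emb (L 2 3)" and ?l33.0 = "emb (L 3 3)",
            OF svar_nonzero refl admittance_fun_eq(1)[OF cb sym] refl])
    finally show ?thesis .
  qed
  have "driving_point_admittance N Y \<longleftrightarrow>
      (\<forall>(V :: ratfun ^ 1) (F :: ratfun ^ 1). F $ 1 = admittance_fun L c b * V $ 1 \<longleftrightarrow> F $ 1 = Y * V $ 1)"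
    unfolding driving_point_admittance_def has_admittance_def beh vec_eq_iff forall_1
      matrix_vector_mult_def vec_lambda_beta sum_1 mat_def by simp
  also have "\<dots> \<longleftrightarrow> Y = admittance_fun L c b"
  proof
    assume "\<forall>(V :: ratfun ^ 1) (F :: ratfun ^ 1). F $ 1 = admittance_fun L c b * V $ 1 \<longleftrightarrow> F $ 1 = Y * V $ 1"
    \<comment> \<open>Unit velocity and force \<open>Y\<close> separate the two candidates.\<close>
    from this[rule_format, of "\<chi> _. Y" "\<chi> _. 1"] show "Y = admittance_fun L c b" by simp
  qed simp
  finally show ?thesis .
qed

section \<open>Coefficient conditions as conditions on a symmetric matrix\<close>

section \<open>The coefficient condition\<close>

definition coefficient_condition ::
  "real \<Rightarrow> real \<Rightarrow> real \<Rightarrow> real \<Rightarrow> real \<Rightarrow> real \<Rightarrow> real \<Rightarrow> bool" where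
  "coefficient_condition \<alpha>\<^sub>0 \<alpha>\<^sub>1 \<alpha>\<^sub>2 \<alpha>\<^sub>3 \<beta>\<^sub>1 \<beta>\<^sub>2 \<beta>\<^sub>3 \<longleftrightarrow>
        \<alpha>\<^sub>0 \<ge> 0 \<and> \<alpha>\<^sub>1 \<ge> 0 \<and> \<alpha>\<^sub>2 \<ge> 0 \<and> \<alpha>\<^sub>3 \<ge> 0 \<and> \<beta>\<^sub>1 \<ge> 0 \<and> \<beta>\<^sub>2 \<ge> 0 \<and> \<beta>\<^sub>3 \<ge> 0 \<and>
        (let W\<^sub>1 = \<alpha>\<^sub>3 * \<beta>\<^sub>3 - \<alpha>\<^sub>2;
             W\<^sub>2 = \<alpha>\<^sub>3 * \<beta>\<^sub>2 - \<alpha>\<^sub>1;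
             W\<^sub>3 = \<beta>\<^sub>2 * \<beta>\<^sub>3 - \<beta>\<^sub>1;
             W = \<alpha>\<^sub>0 + 2 * \<alpha>\<^sub>3 * \<beta>\<^sub>2 * \<beta>\<^sub>3 - \<alpha>\<^sub>3 * \<beta>\<^sub>1 - \<alpha>\<^sub>2 * \<beta>\<^sub>2 - \<alpha>\<^sub>1 * \<beta>\<^sub>3;
             condition1 =
               (\<alpha>\<^sub>1 = 0 \<or> \<alpha>\<^sub>2 = 0 \<or> \<alpha>\<^sub>3 = 0 \<or> \<beta>\<^sub>1 = 0 \<or> \<beta>\<^sub>2 = 0 \<or> \<beta>\<^sub>3 = 0 \<or>
                W\<^sub>1 = 0 \<or> W\<^sub>2 = 0 \<or> W\<^sub>3 = 0 \<or>
                \<beta>\<^sub>2 - W / (2 * W\<^sub>1) = 0 \<or> \<beta>\<^sub>3 - W / (2 * W\<^sub>2) = 0 \<or> \<alpha>\<^sub>3 - W / (2 * W\<^sub>3) = 0)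
         in W\<^sub>1 \<ge> 0 \<and> W\<^sub>2 \<ge> 0 \<and> W\<^sub>3 \<ge> 0 \<and> W\<^sup>2 = 4 * W\<^sub>1 * W\<^sub>2 * W\<^sub>3 \<and>
            (condition1 \<or>
             \<not> condition1 \<and>
               (W < 0 \<and> \<alpha>\<^sub>0 = 0 \<or>
                W > 0 \<and> \<alpha>\<^sub>0 + \<alpha>\<^sub>3 * \<beta>\<^sub>1 + \<alpha>\<^sub>2 * \<beta>\<^sub>2 - \<alpha>\<^sub>1 * \<beta>\<^sub>3 = 0 \<or>
                W > 0 \<and> \<alpha>\<^sub>0 + \<alpha>\<^sub>3 * \<beta>\<^sub>1 + \<alpha>\<^sub>1 * \<beta>\<^sub>3 - \<alpha>\<^sub>2 * \<beta>\<^sub>2 = 0 \<or>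
                W > 0 \<and> \<alpha>\<^sub>0 + \<alpha>\<^sub>1 * \<beta>\<^sub>3 + \<alpha>\<^sub>2 * \<beta>\<^sub>2 - \<alpha>\<^sub>3 * \<beta>\<^sub>1 = 0)))"

definition sym3 :: "real \<Rightarrow> real \<Rightarrow> real \<Rightarrow> real \<Rightarrow> real \<Rightarrow> real \<Rightarrow> 3 \<Rightarrow> 3 \<Rightarrow> real" where
  "sym3 r1 r2 r3 x y z p q =
     (if p = q then (if p = 1 then r1 else if p = 2 then r2 else r3)
      else if p \<noteq> 3 \<and> q \<noteq> 3 then x else if p \<noteq> 2 \<and> q \<noteq> 2 then y else z)"

lemma sym3_simps [simp]:
  "sym3 r1 r2 r3 x y z 1 1 = r1" "sym3 r1 r2 r3 x y z 2 2 = r2" "sym3 r1 r2 r3 x y z 3 3 = r3"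
  "sym3 r1 r2 r3 x y z 1 2 = x" "sym3 r1 r2 r3 x y z 2 1 = x"
  "sym3 r1 r2 r3 x y z 1 3 = y" "sym3 r1 r2 r3 x y z 3 1 = y"
  "sym3 r1 r2 r3 x y z 2 3 = z" "sym3 r1 r2 r3 x y z 3 2 = z"
  by (simp_all add: sym3_def)

lemma det3_sym3: "det3 (sym3 r1 r2 r3 x y z) = r1 * r2 * r3 + 2 * x * y * z - r1 * z\<^sup>2 - r2 * y\<^sup>2 - r3 * x\<^sup>2"
  by (simp add: det3_def algebra_simps power2_eq_square)

lemma ex_perm3:
  fixes P :: "3 \<Rightarrow> 3 \<Rightarrow> 3 \<Rightarrow> bool"
  shows "(\<exists>a b c. distinct [a, b, c] \<and> P a b c) \<longleftrightarrow>
    P 1 2 3 \<or> P 1 3 2 \<or> P 2 1 3 \<or> P 2 3 1 \<or> P 3 1 2 \<or> P 3 2 1"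
  unfolding exists_3 by simp

lemma ex_minor3:
  fixes P :: "3 \<Rightarrow> 3 \<Rightarrow> 3 \<Rightarrow> bool"
  shows "(\<exists>p q r. q \<noteq> p \<and> r \<noteq> p \<and> P p q r) \<longleftrightarrow>
    P 1 2 2 \<or> P 1 2 3 \<or> P 1 3 2 \<or> P 1 3 3 \<or> P 2 1 1 \<or> P 2 1 3 \<or> P 2 3 1 \<or> P 2 3 3 \<or>
    P 3 1 1 \<or> P 3 1 2 \<or> P 3 2 1 \<or> P 3 2 2"
  unfolding exists_3 by auto

lemma three_spring_shape_sym3:
  "three_spring_shape (sym3 r1 r2 r3 x y z) \<longleftrightarrow>
     r1 = 0 \<or> r2 = 0 \<or> r3 = 0 \<or> x = 0 \<or> y = 0 \<or> z = 0 \<or>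
     r1 * r2 = x\<^sup>2 \<or> r1 * r3 = y\<^sup>2 \<or> r2 * r3 = z\<^sup>2 \<or>
     r1 * z = x * y \<or> r2 * y = x * z \<or> r3 * x = y * z \<or>
     x * y * z < 0 \<and> det3 (sym3 r1 r2 r3 x y z) = 0 \<or>
     x * y * z > 0 \<and>
       (r1 * r2 * r3 + x * y * z = r1 * z\<^sup>2 + r2 * y\<^sup>2 \<or>
        r1 * r2 * r3 + x * y * z = r1 * z\<^sup>2 + r3 * x\<^sup>2 \<or>
        r1 * r2 * r3 + x * y * z = r2 * y\<^sup>2 + r3 * x\<^sup>2)"
proof -
  have 1: "(\<exists>p q. sym3 r1 r2 r3 x y z p q = 0) \<longleftrightarrow>
      r1 = 0 \<or> r2 = 0 \<or> r3 = 0 \<or> x = 0 \<or> y = 0 \<or> z = 0"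
    unfolding exists_3 sym3_simps by blast
  have 2: "(\<exists>p q r. q \<noteq> p \<and> r \<noteq> p \<and> sym3 r1 r2 r3 x y z p p * sym3 r1 r2 r3 x y z q r =
      sym3 r1 r2 r3 x y z p q * sym3 r1 r2 r3 x y z p r) \<longleftrightarrow>
      r1 * r2 = x\<^sup>2 \<or> r1 * r3 = y\<^sup>2 \<or> r2 * r3 = z\<^sup>2 \<or> r1 * z = x * y \<or> r2 * y = x * z \<or> r3 * x = y * z"
    unfolding ex_minor3 sym3_simps power2_eq_square mult.commute[of r2 r1] mult.commute[of r3 r1]
      mult.commute[of r3 r2] mult.commute[of y x] mult.commute[of z x] mult.commute[of z y] by blast
  have 3: "(\<exists>a b c. distinct [a, b, c] \<and>
      sym3 r1 r2 r3 x y z a a * sym3 r1 r2 r3 x y z b b * sym3 r1 r2 r3 x y z c c +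
      sym3 r1 r2 r3 x y z a b * sym3 r1 r2 r3 x y z a c * sym3 r1 r2 r3 x y z b c =
      sym3 r1 r2 r3 x y z a a * (sym3 r1 r2 r3 x y z b c)\<^sup>2 + sym3 r1 r2 r3 x y z b b * (sym3 r1 r2 r3 x y z a c)\<^sup>2)
    \<longleftrightarrow> (r1 * r2 * r3 + x * y * z = r1 * z\<^sup>2 + r2 * y\<^sup>2 \<or>
        r1 * r2 * r3 + x * y * z = r1 * z\<^sup>2 + r3 * x\<^sup>2 \<or>
        r1 * r2 * r3 + x * y * z = r2 * y\<^sup>2 + r3 * x\<^sup>2)"
    unfolding ex_perm3 sym3_simps by (auto simp: mult_ac add.commute)
  show ?thesis
    unfolding three_spring_shape_def 1 2 3 sym3_simps by blast
qed

lemma sym3_eq: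
  assumes "\<And>p q. R p q = R q p"
  shows "R = sym3 (R 1 1) (R 2 2) (R 3 3) (R 1 2) (R 1 3) (R 2 3)"
proof (intro ext)
  fix p q :: 3
  show "R p q = sym3 (R 1 1) (R 2 2) (R 3 3) (R 1 2) (R 1 3) (R 2 3) p q"
    using exhaust_3[of p] exhaust_3[of q] assms[of 2 1] assms[of 3 1] assms[of 3 2] by auto
qed

text \<open>The left sides of (b) to (d) are twice the differences of the sides of the shape
  relations, and the quotients in Condition 1 turn into mixed minors after multiplication by an
  off-diagonal entry. The order of the diagonal matters: \<open>\<beta>\<^sub>2\<close> is
  \<open>r3\<close> and \<open>\<beta>\<^sub>3\<close> is \<open>r2\<close>.\<close>

lemma coefficient_condition_sym3:
  fixes r1 r2 r3 x y z :: real
  defines "R \<equiv> sym3 r1 r2 r3 x y z"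
  shows "coefficient_condition (det3 R) (r1 * r3 - y\<^sup>2) (r1 * r2 - x\<^sup>2) r1 (r2 * r3 - z\<^sup>2) r3 r2 \<longleftrightarrow>
    nonneg_minors R \<and> three_spring_shape R"
proof -
  have W1: "r1 * r2 - (r1 * r2 - x\<^sup>2) = x\<^sup>2" and W2: "r1 * r3 - (r1 * r3 - y\<^sup>2) = y\<^sup>2"
    and W3: "r3 * r2 - (r2 * r3 - z\<^sup>2) = z\<^sup>2" by simp_all
  have W: "det3 R + 2 * r1 * r3 * r2 - r1 * (r2 * r3 - z\<^sup>2) - (r1 * r2 - x\<^sup>2) * r3 - (r1 * r3 - y\<^sup>2) * r2 =
      2 * (x * y * z)"
    unfolding R_def det3_sym3 by (simp add: algebra_simps)
  have sq: "(2 * (x * y * z))\<^sup>2 = 4 * x\<^sup>2 * y\<^sup>2 * z\<^sup>2"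
    by (simp add: power2_eq_square)
  have b: "det3 R + r1 * (r2 * r3 - z\<^sup>2) + (r1 * r2 - x\<^sup>2) * r3 - (r1 * r3 - y\<^sup>2) * r2 = 0 \<longleftrightarrow>
      r1 * r2 * r3 + x * y * z = r1 * z\<^sup>2 + r3 * x\<^sup>2"
    "det3 R + r1 * (r2 * r3 - z\<^sup>2) + (r1 * r3 - y\<^sup>2) * r2 - (r1 * r2 - x\<^sup>2) * r3 = 0 \<longleftrightarrow>
      r1 * r2 * r3 + x * y * z = r1 * z\<^sup>2 + r2 * y\<^sup>2"
    "det3 R + (r1 * r3 - y\<^sup>2) * r2 + (r1 * r2 - x\<^sup>2) * r3 - r1 * (r2 * r3 - z\<^sup>2) = 0 \<longleftrightarrow>
      r1 * r2 * r3 + x * y * z = r2 * y\<^sup>2 + r3 * x\<^sup>2"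
    unfolding R_def det3_sym3 by (simp_all add: algebra_simps, linarith+)
  have frac: "t - 2 * (x * y * z) / (2 * u\<^sup>2) = 0 \<longleftrightarrow> t * u = v * w"
    if "u \<noteq> 0" "x * y * z = u * v * w" for t u v w
    using that(1) unfolding that(2) by (simp add: field_simps power2_eq_square)
  have fr: "x \<noteq> 0 \<Longrightarrow> r3 - 2 * (x * y * z) / (2 * x\<^sup>2) = 0 \<longleftrightarrow> r3 * x = y * z"
    "y \<noteq> 0 \<Longrightarrow> r2 - 2 * (x * y * z) / (2 * y\<^sup>2) = 0 \<longleftrightarrow> r2 * y = x * z"
    "z \<noteq> 0 \<Longrightarrow> r1 - 2 * (x * y * z) / (2 * z\<^sup>2) = 0 \<longleftrightarrow> r1 * z = x * y"
    by (rule frac; simp)+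
  have minors: "nonneg_minors R \<longleftrightarrow> 0 \<le> det3 R \<and> 0 \<le> r1 * r3 - y\<^sup>2 \<and> 0 \<le> r1 * r2 - x\<^sup>2 \<and> 0 \<le> r1 \<and>
      0 \<le> r2 * r3 - z\<^sup>2 \<and> 0 \<le> r3 \<and> 0 \<le> r2"
    unfolding nonneg_minors_def forall_3 R_def sym3_simps mult.commute[of r2 r1] mult.commute[of r3 r1]
      mult.commute[of r3 r2] diff_ge_0_iff_ge power2_eq_square
    by (blast intro: order_refl)
  have signs: "2 * (x * y * z) < 0 \<longleftrightarrow> x * y * z < 0" "2 * (x * y * z) > 0 \<longleftrightarrow> x * y * z > 0" by auto
  have zero: "r1 * r2 - x\<^sup>2 = 0 \<longleftrightarrow> r1 * r2 = x\<^sup>2" "r1 * r3 - y\<^sup>2 = 0 \<longleftrightarrow> r1 * r3 = y\<^sup>2"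
    "r2 * r3 - z\<^sup>2 = 0 \<longleftrightarrow> r2 * r3 = z\<^sup>2" "x\<^sup>2 = 0 \<longleftrightarrow> x = 0" "y\<^sup>2 = 0 \<longleftrightarrow> y = 0" "z\<^sup>2 = 0 \<longleftrightarrow> z = 0"
    by simp_all
  have eq: "4 * x\<^sup>2 * y\<^sup>2 * z\<^sup>2 = 4 * x\<^sup>2 * y\<^sup>2 * z\<^sup>2 \<longleftrightarrow> True"
    "0 \<le> x\<^sup>2 \<longleftrightarrow> True" "0 \<le> y\<^sup>2 \<longleftrightarrow> True" "0 \<le> z\<^sup>2 \<longleftrightarrow> True"
    by simp_all
  show ?thesis
  \<comment> \<open>If an off-diagonal entry vanishes, a quotient has denominator zero, but
    Condition 1 and the first alternative of the shape hold anyway.\<close>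
  proof (cases "x = 0 \<or> y = 0 \<or> z = 0")
    case True
    then show ?thesis
      unfolding coefficient_condition_def Let_def W1 W2 W3 W b sq signs minors zero eq
      unfolding R_def three_spring_shape_sym3 by blast
  next
    case False
    then have "x \<noteq> 0" "y \<noteq> 0" "z \<noteq> 0" by blast+
    then show ?thesis
      unfolding coefficient_condition_def Let_def W1 W2 W3 W b sq signs minors zero eq
        fr(1)[OF \<open>x \<noteq> 0\<close>] fr(2)[OF \<open>y \<noteq> 0\<close>] fr(3)[OF \<open>z \<noteq> 0\<close>]
      unfolding R_def three_spring_shape_sym3 by blast
  qed
qed

text \<open>The coefficients give the diagonal of \<open>R\<close> and the squares of its other
  entries; the equation for \<open>W\<^sup>2\<close> leaves only a sign to choose.\<close>

lemma coefficient_condition_iff: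
  "coefficient_condition \<alpha>\<^sub>0 \<alpha>\<^sub>1 \<alpha>\<^sub>2 \<alpha>\<^sub>3 \<beta>\<^sub>1 \<beta>\<^sub>2 \<beta>\<^sub>3 \<longleftrightarrow>
     (\<exists>R. nonneg_minors R \<and> three_spring_shape R \<and> \<alpha>\<^sub>0 = det3 R \<and> \<alpha>\<^sub>1 = R 1 1 * R 3 3 - (R 1 3)\<^sup>2 \<and>
        \<alpha>\<^sub>2 = R 1 1 * R 2 2 - (R 1 2)\<^sup>2 \<and> \<alpha>\<^sub>3 = R 1 1 \<and> \<beta>\<^sub>1 = R 2 2 * R 3 3 - (R 2 3)\<^sup>2 \<and> \<beta>\<^sub>2 = R 3 3 \<and> \<beta>\<^sub>3 = R 2 2)"
  (is "?L \<longleftrightarrow> ?R")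
proof
  assume ?R
  then obtain R where R: "nonneg_minors R" "three_spring_shape R" and co: "\<alpha>\<^sub>0 = det3 R" "\<alpha>\<^sub>1 = R 1 1 * R 3 3 - (R 1 3)\<^sup>2"
    "\<alpha>\<^sub>2 = R 1 1 * R 2 2 - (R 1 2)\<^sup>2" "\<alpha>\<^sub>3 = R 1 1" "\<beta>\<^sub>1 = R 2 2 * R 3 3 - (R 2 3)\<^sup>2" "\<beta>\<^sub>2 = R 3 3" "\<beta>\<^sub>3 = R 2 2"
    by blast
  have "R p q = R q p" for p q using R(1) unfolding nonneg_minors_def by blast
  then have eq: "sym3 (R 1 1) (R 2 2) (R 3 3) (R 1 2) (R 1 3) (R 2 3) = R" by (rule sym3_eq[symmetric])
  show ?L
    unfolding co using coefficient_condition_sym3[of "R 1 1" "R 2 2" "R 3 3" "R 1 2" "R 1 3" "R 2 3"] R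
    unfolding eq by blast
next
  assume L: ?L
  define W where "W = \<alpha>\<^sub>0 + 2 * \<alpha>\<^sub>3 * \<beta>\<^sub>2 * \<beta>\<^sub>3 - \<alpha>\<^sub>3 * \<beta>\<^sub>1 - \<alpha>\<^sub>2 * \<beta>\<^sub>2 - \<alpha>\<^sub>1 * \<beta>\<^sub>3"
  have nn: "\<alpha>\<^sub>3 * \<beta>\<^sub>3 - \<alpha>\<^sub>2 \<ge> 0" "\<alpha>\<^sub>3 * \<beta>\<^sub>2 - \<alpha>\<^sub>1 \<ge> 0" "\<beta>\<^sub>2 * \<beta>\<^sub>3 - \<beta>\<^sub>1 \<ge> 0"
    and W2: "W\<^sup>2 = 4 * (\<alpha>\<^sub>3 * \<beta>\<^sub>3 - \<alpha>\<^sub>2) * (\<alpha>\<^sub>3 * \<beta>\<^sub>2 - \<alpha>\<^sub>1) * (\<beta>\<^sub>2 * \<beta>\<^sub>3 - \<beta>\<^sub>1)"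
    using L unfolding coefficient_condition_def Let_def W_def by blast+
  define x where "x = sqrt (\<alpha>\<^sub>3 * \<beta>\<^sub>3 - \<alpha>\<^sub>2)"
  define y where "y = sqrt (\<alpha>\<^sub>3 * \<beta>\<^sub>2 - \<alpha>\<^sub>1)"
  \<comment> \<open>Only the sign of the product of the three entries matters, so \<open>z\<close>
    alone carries the sign of \<open>W\<close>.\<close>
  define z where "z = (if W \<ge> 0 then sqrt (\<beta>\<^sub>2 * \<beta>\<^sub>3 - \<beta>\<^sub>1) else - sqrt (\<beta>\<^sub>2 * \<beta>\<^sub>3 - \<beta>\<^sub>1))"
  have sq: "x\<^sup>2 = \<alpha>\<^sub>3 * \<beta>\<^sub>3 - \<alpha>\<^sub>2" "y\<^sup>2 = \<alpha>\<^sub>3 * \<beta>\<^sub>2 - \<alpha>\<^sub>1" "z\<^sup>2 = \<beta>\<^sub>2 * \<beta>\<^sub>3 - \<beta>\<^sub>1"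
    using nn unfolding x_def y_def z_def by simp_all
  have W: "W = 2 * x * y * z"
  proof -
    have "W\<^sup>2 = (2 * x * y * z)\<^sup>2"
      unfolding W2 power_mult_distrib sq by simp
    moreover have "0 \<le> x" "0 \<le> y" using nn unfolding x_def y_def by simp_all
    moreover have "W \<ge> 0 \<Longrightarrow> 0 \<le> z" "\<not> W \<ge> 0 \<Longrightarrow> z \<le> 0" using nn unfolding z_def by simp_all
    ultimately show ?thesis
      by (cases "W \<ge> 0") (auto simp: power2_eq_iff mult_nonneg_nonpos mult_nonneg_nonneg
          dest: antisym[of 0])
  qed
  let ?S = "sym3 \<alpha>\<^sub>3 \<beta>\<^sub>3 \<beta>\<^sub>2 x y z"
  have det: "\<alpha>\<^sub>0 = det3 ?S"
    unfolding det3_sym3 sq using W unfolding W_def by (simp add: algebra_simps)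
  have co: "\<alpha>\<^sub>1 = \<alpha>\<^sub>3 * \<beta>\<^sub>2 - y\<^sup>2" "\<alpha>\<^sub>2 = \<alpha>\<^sub>3 * \<beta>\<^sub>3 - x\<^sup>2" "\<beta>\<^sub>1 = \<beta>\<^sub>3 * \<beta>\<^sub>2 - z\<^sup>2"
    unfolding sq by simp_all
  have "nonneg_minors ?S \<and> three_spring_shape ?S"
    using L coefficient_condition_sym3[of \<alpha>\<^sub>3 \<beta>\<^sub>3 \<beta>\<^sub>2 x y z]
    unfolding det[symmetric] co(1)[symmetric] co(2)[symmetric] co(3)[symmetric] by blast
  then show ?R
    using det co by (intro exI[of _ ?S]) simp
qed

section \<open>Networks whose ports form a spanning tree\<close>

section \<open>Realization\<close>

text \<open>The port velocities determine node velocities up to a constant, with \<open>T p\<close>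
  as dual node functions. So all arc elongations are combinations of port velocities, and the
  admittance is \<open>M^T K M / s\<close>.\<close>

lemma (in ported_network) tree_admittance:
  fixes T :: "'p \<Rightarrow> 'a \<Rightarrow> real"
  assumes dual: "\<And>p q. elong (T p) (P q) = (if p = q then 1 else 0)"
    and tree: "\<And>w :: 'a \<Rightarrow> ratfun. \<exists>a. \<forall>x\<in>verts G. w x = a + (\<Sum>p\<in>UNIV. elong w (P p) * emb (T p x))"
  shows "has_admittance G (\<lambda>e. emb (k e) / svar) P
    (\<chi> p q. emb (\<Sum>e\<in>arcs G. k e * elong (T p) (arc_to_ends G e) * elong (T q) (arc_to_ends G e)) / svar)"
    (is "has_admittance G ?y P ?A")
proof -
  let ?e = "arc_to_ends G"
  have el: "elong w (?e e) = (\<Sum>p\<in>UNIV. elong w (P p) * emb (elong (T p) (?e e)))" if "e \<in> arcs G" for w e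
  proof -
    obtain a where "\<forall>x\<in>verts G. w x = a + (\<Sum>p\<in>UNIV. elong w (P p) * emb (T p x))"
      using tree by blast
    then have "elong w (?e e) = (a + (\<Sum>p\<in>UNIV. elong w (P p) * emb (T p (tail G e)))) -
        (a + (\<Sum>p\<in>UNIV. elong w (P p) * emb (T p (head G e))))"
      using that by (simp add: elong_def arc_to_ends_def)
    also have "\<dots> = (\<Sum>p\<in>UNIV. elong w (P p) * (emb (T p (tail G e)) - emb (T p (head G e))))"
      by (simp add: sum_subtractf right_diff_distrib)
    finally show ?thesis by (simp add: elong_def[of "T _"] arc_to_ends_def emb_diff)
  qed
  have AV: "(?A *v V) $ q = (\<Sum>e\<in>arcs G. ?y e * (\<Sum>p\<in>UNIV. V $ p * emb (elong (T p) (?e e))) * emb (elong (T q) (?e e)))"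
    for V q
  proof -
    have "(?A *v V) $ q = (\<Sum>p\<in>UNIV. \<Sum>e\<in>arcs G. ?y e * (V $ p * emb (elong (T p) (?e e))) * emb (elong (T q) (?e e)))"
      by (simp add: matrix_vector_mult_def emb_sum emb_mult sum_divide_distrib sum_distrib_left sum_distrib_right mult_ac)
    also have "\<dots> = (\<Sum>e\<in>arcs G. \<Sum>p\<in>UNIV. ?y e * (V $ p * emb (elong (T p) (?e e))) * emb (elong (T q) (?e e)))"
      by (rule sum.swap)
    finally show ?thesis by (simp add: sum_distrib_left sum_distrib_right)
  qed
  have "port_behaviour G ?y P V F \<longleftrightarrow> F = ?A *v V" for V F
  proof
    assume "port_behaviour G ?y P V F"
    then obtain v where v: "\<And>p. V $ p = elong v (P p)" and w: "\<And>w. virtual_power G ?y P v (($) F) w"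
      unfolding port_behaviour_iff by blast
    have "F $ q = (?A *v V) $ q" for q
    proof -
      \<comment> \<open>Testing with \<open>T q\<close> isolates the force at port
        \<open>q\<close>.\<close>
      have "F $ q = (\<Sum>p\<in>UNIV. F $ p * elong (\<lambda>x. emb (T q x)) (P p))"
        unfolding elong_emb dual by (simp add: emb_if if_distrib[of "(*) _"] cong: if_cong)
      also have "\<dots> = (\<Sum>e\<in>arcs G. ?y e * elong v (?e e) * elong (\<lambda>x. emb (T q x)) (?e e))"
        using w[of "\<lambda>x. emb (T q x)"] unfolding virtual_power_def by simp
      also have "\<dots> = (?A *v V) $ q"
        unfolding AV elong_emb by (rule sum.cong) (simp_all add: el[of _ v] v)
      finally show ?thesis .
    qed
    then show "F = ?A *v V" unfolding vec_eq_iff by blast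
  next
    assume F: "F = ?A *v V"
    define v where "v x = (\<Sum>p\<in>UNIV. V $ p * emb (T p x))" for x
    have ev: "elong v e = (\<Sum>p\<in>UNIV. V $ p * emb (elong (T p) e))" for e
      unfolding v_def elong_sum elong_scale elong_emb ..
    have "V $ q = elong v (P q)" for q
      unfolding ev dual by (simp add: emb_if if_distrib[of "(*) _"] cong: if_cong)
    moreover have "virtual_power G ?y P v (($) F) w" for w
    proof -
      have "(\<Sum>e\<in>arcs G. ?y e * elong v (?e e) * elong w (?e e)) =
          (\<Sum>e\<in>arcs G. \<Sum>q\<in>UNIV. ?y e * elong v (?e e) * emb (elong (T q) (?e e)) * elong w (P q))"
        by (rule sum.cong) (simp_all add: el[of _ w] sum_distrib_left mult_ac)
      also have "\<dots> = (\<Sum>q\<in>UNIV. \<Sum>e\<in>arcs G. ?y e * elong v (?e e) * emb (elong (T q) (?e e)) * elong w (P q))"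
        by (rule sum.swap)
      also have "\<dots> = (\<Sum>q\<in>UNIV. F $ q * elong w (P q))"
        unfolding F AV ev sum_distrib_right ..
      finally show ?thesis unfolding virtual_power_def .
    qed
    ultimately show "port_behaviour G ?y P V F"
      unfolding port_behaviour_iff by blast
  qed
  then show ?thesis unfolding has_admittance_def by blast
qed

lemma has_admittance_cong:
  assumes "\<And>e. e \<in> arcs G \<Longrightarrow> y e = y' e"
  shows "has_admittance G y P A \<longleftrightarrow> has_admittance G y' P A"
  unfolding has_admittance_def port_behaviour_def using assms by simp

definition realizable :: "ratfun \<Rightarrow> bool" where
  "realizable Y \<longleftrightarrow>
    (\<exists>(N :: (nat, nat) mech_network) d i.
        wf_network N \<and> dampers N = {d} \<and> inerters N = {i} \<and> card (springs N) \<le> 3 \<and>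
        X_well_defined N d i \<and> driving_point_admittance N Y)"

text \<open>The network has nodes \<open>0\<close> to \<open>3\<close>; arc \<open>0\<close> is the
  damper, arc \<open>1\<close> the inerter and arc \<open>j + 2\<close> spring
  \<open>j\<close>.\<close>

lemma realizable_tree:
  fixes P :: "3 \<Rightarrow> nat \<times> nat" and E :: "nat \<Rightarrow> nat \<times> nat" and T :: "3 \<Rightarrow> nat \<Rightarrow> real"
  assumes P: "\<And>p. fst (P p) < 4" "\<And>p. snd (P p) < 4"
    and E: "\<And>j. j < 3 \<Longrightarrow> fst (E j) < 4 \<and> snd (E j) < 4 \<and> fst (E j) \<noteq> snd (E j)"
    and dual: "\<And>p q. elong (T p) (P q) = (if p = q then 1 else 0)"
    and tree: "\<And>w :: nat \<Rightarrow> ratfun. \<forall>x<4. w x = w 0 + (\<Sum>p\<in>UNIV. elong w (P p) * emb (T p x))"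
    and k: "\<And>j. j < 3 \<Longrightarrow> 0 \<le> k j" and c: "c > 0" and b: "b > 0"
  shows "realizable (admittance_fun (gram k (\<lambda>j p. elong (T p) (E j))) c b)"
proof -
  define ends where "ends e = (if e = 0 then P 2 else if e = 1 then P 3 else E (e - 2))" for e :: nat
  \<comment> \<open>Element values must be positive, so springs with constant \<open>0\<close> are
    left out.\<close>
  define J where "J = {j. j < 3 \<and> 0 < k j}"
  define S where "S = (\<lambda>j. j + 2) ` J"
  define G :: "(nat, nat) pre_digraph" where
    "G = \<lparr>verts = {..<4}, arcs = {0, 1} \<union> S, tail = \<lambda>e. fst (ends e), head = \<lambda>e. snd (ends e)\<rparr>"
  define N :: "(nat, nat) mech_network" where
    "N = \<lparr>net_graph = G, element_of = \<lambda>e. if e = 0 then Damper c else if e = 1 then Inerter b else Spring (k (e - 2)),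
      driving_port = P 1\<rparr>"
  have J: "finite J" "J \<subseteq> {..<3}" unfolding J_def by auto
  have S: "finite S" "0 \<notin> S" "1 \<notin> S" "\<And>e. e \<in> S \<Longrightarrow> \<exists>j. e = j + 2 \<and> j < 3 \<and> 0 < k j"
    using J unfolding S_def J_def by auto
  have P_neq: "fst (P p) \<noteq> snd (P p)" for p
    using dual[of p p] by (auto simp: elong_def)
  have d: "dampers N = {0}" and i: "inerters N = {1}" and s: "springs N = S"
    using S unfolding dampers_def inerters_def springs_def N_def G_def by auto
  have e: "fst (ends e) < 4" "snd (ends e) < 4" "fst (ends e) \<noteq> snd (ends e)" if "e \<in> {0, 1} \<union> S" for e
    using that P P_neq E S(4) unfolding ends_def by force+
  have fin: "fin_digraph G"
    by unfold_locales (use e S(1) in \<open>auto simp: G_def\<close>)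
  have loop: "loopfree_digraph G"
    by unfold_locales (use e S(1) in \<open>auto simp: G_def\<close>)
  have pos: "element_value (element_of N e) > 0" if "e \<in> {0, 1} \<union> S" for e
    using that S(4)[of e] c b unfolding N_def by auto
  have wf: "wf_network N"
    unfolding wf_network_def using fin loop pos P P_neq by (simp add: N_def G_def)
  have X: "X_ports N 0 1 = P"
  proof
    fix p show "X_ports N 0 1 p = P p"
      using exhaust_3[of p] by (auto simp: X_ports_def N_def G_def arc_to_ends_def ends_def)
  qed
  have card: "card (springs N) \<le> 3"
    unfolding s S_def using card_image_le[OF J(1), of "\<lambda>j. j + 2"] card_mono[OF _ J(2)] by simp
  interpret X: ported_network "spring_graph N" P
    by unfold_locales
      (use P e S(1) s in \<open>auto simp: spring_graph_def N_def G_def\<close>)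
  let ?M = "\<lambda>j p. elong (T p) (E j)"
  let ?L = "\<lambda>p q. \<Sum>e\<in>arcs (spring_graph N). k (e - 2) *
      elong (T p) (arc_to_ends (spring_graph N) e) * elong (T q) (arc_to_ends (spring_graph N) e)"
  have arcs: "arcs (spring_graph N) = S" by (simp add: spring_graph_def s)
  have verts: "verts (spring_graph N) = {..<4}" by (simp add: spring_graph_def N_def G_def)
  have L: "?L p q = gram k ?M p q" for p q
  proof -
    have "?L p q = (\<Sum>j\<in>J. k j * ?M j p * ?M j q)"
      unfolding arcs unfolding S_def
      by (subst sum.reindex) (auto simp: inj_on_def spring_graph_def arc_to_ends_def N_def G_def ends_def)
    also have "\<dots> = (\<Sum>j<3. k j * ?M j p * ?M j q)"
      by (rule sum.mono_neutral_left) (use J k in \<open>force simp: J_def\<close>)+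
    finally show ?thesis unfolding gram_def .
  qed
  have "has_admittance (spring_graph N) (\<lambda>e. emb (k (e - 2)) / svar) P (\<chi> p q. emb (?L p q) / svar)"
  proof (rule X.tree_admittance[OF dual])
    fix w :: "nat \<Rightarrow> ratfun"
    show "\<exists>a. \<forall>x\<in>verts (spring_graph N). w x = a + (\<Sum>p\<in>UNIV. elong w (P p) * emb (T p x))"
      unfolding verts Ball_def lessThan_iff using tree[of w] by blast
  qed
  moreover have spring: "element_admittance (element_of N e) = emb (k (e - 2)) / svar"
    if "e \<in> arcs (spring_graph N)" for e
  proof -
    have "e \<noteq> 0" "e \<noteq> 1" using that S(2,3) unfolding arcs by metis+
    then show ?thesis unfolding N_def by (simp add: element_admittance_emb(1)[simplified])
  qed
  ultimately have A: "has_admittance (spring_graph N) (\<lambda>e. element_admittance (element_of N e)) (X_ports N 0 1)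
      (\<chi> p q. emb (gram k ?M p q) / svar)"
    unfolding X L
    using has_admittance_cong[where G = "spring_graph N" and P = P and
        y = "\<lambda>e. element_admittance (element_of N e)" and y' = "\<lambda>e. emb (k (e - 2)) / svar"] by blast
  have "driving_point_admittance N (admittance_fun (gram k ?M) c b)"
    by (rule driving_point_admittance_iff[OF wf d i _ _ A, THEN iffD2])
      (simp_all add: N_def gram_def mult_ac)
  moreover have "X_well_defined N 0 1" unfolding X_well_defined_def using A by blast
  ultimately show ?thesis unfolding realizable_def using wf d i card by blast
qed

text \<open>The common factor \<open>(d 1)\<^sup>2\<close> is moved into the spring constants; the
  squares of \<open>d 2 / d 1\<close> and \<open>d 3 / d 1\<close> become the damper and inerter
  constants.\<close>

lemma realizable_scaled:
  assumes g: "\<And>k c b. (\<And>j. j < 3 \<Longrightarrow> 0 \<le> k j) \<Longrightarrow> c > 0 \<Longrightarrow> b > 0 \<Longrightarrow> realizable (admittance_fun (gram k M) c b)"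
    and d: "\<And>p. d p \<noteq> 0" and k: "\<And>j. j < 3 \<Longrightarrow> 0 \<le> k j"
    and R: "\<And>p q. d p * d q * R p q = gram k M p q"
  shows "realizable (admittance_fun R 1 1)"
proof -
  define d' where "d' p = d p / d 1" for p
  define k' where "k' j = k j / (d 1)\<^sup>2" for j
  have "d' p * d' q * R p q = gram k' M p q" for p q
  proof -
    have "d' p * d' q * R p q = (d p * d q * R p q) / (d 1)\<^sup>2"
      unfolding d'_def by (simp add: power2_eq_square)
    also have "\<dots> = gram k' M p q"
      unfolding R gram_def k'_def by (simp add: sum_divide_distrib)
    finally show ?thesis .
  qed
  then have "gram k' M = (\<lambda>p q. d' p * d' q * R p q)" by (intro ext) simp
  then have "admittance_fun (gram k' M) ((d' 2)\<^sup>2) ((d' 3)\<^sup>2) = admittance_fun R 1 1"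
    using admittance_fun_scale[of d' R] d by (simp add: d'_def)
  moreover have "realizable (admittance_fun (gram k' M) ((d' 2)\<^sup>2) ((d' 3)\<^sup>2))"
    by (rule g) (use k d in \<open>auto simp: k'_def d'_def\<close>)
  ultimately show ?thesis by simp
qed

lemma three_UNIV:
  assumes "distinct [a, b, c :: 3]"
  shows "UNIV = {a, b, c}"
  using assms exhaust_3[of a] exhaust_3[of b] exhaust_3[of c] UNIV_3 by auto

lemma forall_perm3:
  assumes "distinct [a, b, c :: 3]"
  shows "(\<forall>p. Q p) \<longleftrightarrow> Q a \<and> Q b \<and> Q c"
proof -
  have "(\<forall>p. Q p) \<longleftrightarrow> (\<forall>p\<in>{a, b, c}. Q p)" using three_UNIV[OF assms] by simp
  then show ?thesis by simp
qed

lemma sum_perm3: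
  assumes "distinct [a, b, c :: 3]"
  shows "(\<Sum>p\<in>UNIV. f p) = f a + (f b + f c)"
  unfolding three_UNIV[OF assms] using assms by simp

section \<open>Spring networks on a path and on a star of ports\<close>

text \<open>
  The ports \<open>a\<close>, \<open>c\<close>, \<open>b\<close> are the successive edges of the path \<open>0, 1, 2, 3\<close>; the port at position
  \<open>t\<close> contributes \<open>threshold t e\<close> to the elongation of \<open>e\<close>.
\<close>
definition threshold :: "nat \<Rightarrow> nat \<times> nat \<Rightarrow> real" where
  "threshold t e = of_bool (t \<le> fst e) - of_bool (t \<le> snd e)"

definition three :: "'a \<Rightarrow> 'a \<Rightarrow> 'a \<Rightarrow> nat \<Rightarrow> 'a" where
  "three x y z j = (if j = 0 then x else if j = 1 then y else z)"

lemma three_simps [simp]: "three x y z 0 = x" "three x y z (Suc 0) = y" "three x y z 2 = z"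
  by (simp_all add: three_def)

lemma less_4_cases: "x < 4 \<longleftrightarrow> x = 0 \<or> x = 1 \<or> x = 2 \<or> x = (3::nat)"
  by auto

lemma realizable_path:
  fixes R :: "3 \<Rightarrow> 3 \<Rightarrow> real"
  assumes abc: "distinct [a, b, c :: 3]" and sym: "\<And>p q. R p q = R q p"
    and E: "{e\<^sub>0, e\<^sub>1, e\<^sub>2} \<subseteq> {(1, 0), (2, 1), (3, 2), (2, 0), (3, 1), (3, 0)}"
    and d: "da \<noteq> 0" "db \<noteq> 0" "dc \<noteq> 0" and k: "0 \<le> k\<^sub>0" "0 \<le> k\<^sub>1" "0 \<le> k\<^sub>2"
  defines "H \<equiv> \<lambda>s t. k\<^sub>0 * threshold s e\<^sub>0 * threshold t e\<^sub>0 + k\<^sub>1 * threshold s e\<^sub>1 * threshold t e\<^sub>1 +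
      k\<^sub>2 * threshold s e\<^sub>2 * threshold t e\<^sub>2"
  assumes H: "da * da * R a a = H 1 1" "dc * dc * R c c = H 2 2" "db * db * R b b = H 3 3"
    "da * dc * R a c = H 1 2" "da * db * R a b = H 1 3" "dc * db * R c b = H 2 3"
  shows "realizable (admittance_fun R 1 1)"
proof -
  have R: "three da dc db (s - 1) * three da dc db (t - 1) * R x y = H s t"
    if "(s, x) \<in> {(1, a), (2, c), (3, b)}" "(t, y) \<in> {(1, a), (2, c), (3, b)}" "s \<le> t" for s t x y
  proof -
    have "s = 1 \<and> x = a \<or> s = 2 \<and> x = c \<or> s = 3 \<and> x = b"
      "t = 1 \<and> y = a \<or> t = 2 \<and> y = c \<or> t = 3 \<and> y = b"
      using that(1,2) by simp_all
    then show ?thesis using that(3) H by (elim disjE conjE) (simp_all add: three_def)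
  qed
  define pos where "pos p = (if p = a then 1 else if p = c then 2 else 3 :: nat)" for p
  define T where "T p x = (of_bool (pos p \<le> x) :: real)" for p and x :: nat
  define P where "P p = (pos p, pos p - 1)" for p
  define E' where "E' = three e\<^sub>0 e\<^sub>1 e\<^sub>2"
  define k' where "k' = three k\<^sub>0 k\<^sub>1 k\<^sub>2"
  define d' where "d' p = three da dc db (pos p - 1)" for p
  have pos: "pos a = 1" "pos c = 2" "pos b = 3" using abc unfolding pos_def by auto
  have ET: "elong (T p) e = threshold (pos p) e" for p e
    unfolding elong_def T_def threshold_def ..
  have k': "0 \<le> k' j" for j using k unfolding k'_def three_def by simp
  \<comment> \<open>Telescoping from node \<open>0\<close> along the path.\<close>
  have tree: "\<forall>x<4. w x = w 0 + (\<Sum>p\<in>UNIV. elong w (P p) * emb (T p x))" for w :: "nat \<Rightarrow> ratfun"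
    unfolding sum_perm3[OF abc] less_4_cases elong_def P_def T_def pos by (auto simp: eval_nat_numeral)
  have dual: "elong (T p) (P q) = (if p = q then 1 else 0)" for p q
  proof -
    have "\<forall>p q. elong (T p) (P q) = (if p = q then 1 else 0)"
      unfolding forall_perm3[OF abc] elong_def P_def T_def pos using abc by auto
    then show ?thesis by blast
  qed
  have R': "d' p * d' q * R p q = gram k' (\<lambda>j p. elong (T p) (E' j)) p q" for p q
  proof -
    have *: "d' p * d' q * R p q = gram k' (\<lambda>j p. elong (T p) (E' j)) p q" if "pos p \<le> pos q" for p q
    proof -
      have in3: "(pos p, p) \<in> {(1, a), (2, c), (3, b)}" for p
      proof -
        have "\<forall>p. (pos p, p) \<in> {(1, a), (2, c), (3, b)}"
          unfolding forall_perm3[OF abc] pos by simp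
        then show ?thesis by blast
      qed
      show ?thesis
        unfolding gram_def sum_lessThan_3 ET d'_def R[OF in3 in3 that] H_def
        by (simp add: k'_def E'_def)
    qed
    show ?thesis
    proof (cases "pos p \<le> pos q")
      case False
      then show ?thesis using *[of q p] sym[of p q] by (simp add: gram_def mult_ac)
    qed (rule *)
  qed
  show ?thesis
  proof (rule realizable_scaled[OF _ _ k' R'])
    fix k :: "nat \<Rightarrow> real" and c b assume "\<And>j. j < 3 \<Longrightarrow> 0 \<le> k j" "(c :: real) > 0" "(b :: real) > 0"
    then show "realizable (admittance_fun (gram k (\<lambda>j p. elong (T p) (E' j))) c b)"
    proof (intro realizable_tree[OF _ _ _ dual tree])
      fix j :: nat assume "j < 3"
      have "E' j \<in> {e\<^sub>0, e\<^sub>1, e\<^sub>2}" unfolding E'_def three_def by simp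
      then show "fst (E' j) < 4 \<and> snd (E' j) < 4 \<and> fst (E' j) \<noteq> snd (E' j)"
        using E by fastforce
    qed (auto simp: P_def pos_def)
  qed (use d in \<open>auto simp: d'_def three_def\<close>)
qed

text \<open>Ports join node \<open>0\<close> to the other nodes, and springs join those in pairs.
  Since \<open>d\<close> lies in the kernel of \<open>R\<close>, the scaled matrix has zero row
  sums; with nonpositive off-diagonal entries it is the weighted Laplacian of a triangle.\<close>

lemma realizable_triangle:
  fixes R :: "3 \<Rightarrow> 3 \<Rightarrow> real" and d :: "3 \<Rightarrow> real"
  assumes sym: "\<And>p q. R p q = R q p"
    and d: "\<And>p. d p \<noteq> 0" and neg: "d 1 * d 2 * R 1 2 \<le> 0" "d 1 * d 3 * R 1 3 \<le> 0" "d 2 * d 3 * R 2 3 \<le> 0"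
    and row: "\<And>p. R p 1 * d 1 + R p 2 * d 2 + R p 3 * d 3 = 0"
  shows "realizable (admittance_fun R 1 1)"
proof -
  define pos where "pos p = (if p = 1 then 1 else if p = 2 then 2 else 3 :: nat)" for p :: 3
  define T where "T p x = (of_bool (pos p = x) :: real)" for p and x :: nat
  define P where "P p = (pos p, 0 :: nat)" for p
  define E where "E = three (1, 2) (1, 3) (2 :: nat, 3 :: nat)"
  define k where "k = three (- (d 1 * d 2 * R 1 2)) (- (d 1 * d 3 * R 1 3)) (- (d 2 * d 3 * R 2 3))"
  have pos: "pos 1 = 1" "pos 2 = 2" "pos 3 = 3" unfolding pos_def by simp_all
  have k: "0 \<le> k j" for j using neg unfolding k_def three_def by simp
  have tree: "\<forall>x<4. w x = w 0 + (\<Sum>p\<in>UNIV. elong w (P p) * emb (T p x))" for w :: "nat \<Rightarrow> ratfun"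
    unfolding sum_3 less_4_cases elong_def P_def T_def pos by auto
  have dual: "elong (T p) (P q) = (if p = q then 1 else 0)" for p q
  proof -
    have "\<forall>p q. elong (T p) (P q) = (if p = q then 1 else 0)"
      unfolding forall_3 elong_def P_def T_def pos by simp
    then show ?thesis by blast
  qed
  have diag: "d p * d p * R p p = - (d p * d q * R p q) - d p * d r * R p r"
    if "R p p * d p + R p q * d q + R p r * d r = 0" for p q r
  proof -
    have "d p * (R p p * d p + R p q * d q + R p r * d r) = 0" using that by simp
    then show ?thesis by (simp add: algebra_simps)
  qed
  have R': "d p * d q * R p q = gram k (\<lambda>j p. elong (T p) (E j)) p q" for p q
  proof -
    have "\<forall>p q. d p * d q * R p q = gram k (\<lambda>j p. elong (T p) (E j)) p q"
      unfolding forall_3 gram_def sum_lessThan_3 elong_def T_def pos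
      using diag[of 1 2 3] diag[of 2 1 3] diag[of 3 1 2] row[of 1] row[of 2] row[of 3]
        sym[of 2 1] sym[of 3 1] sym[of 3 2]
      by (simp add: k_def E_def algebra_simps)
    then show ?thesis by blast
  qed
  show ?thesis
  proof (rule realizable_scaled[OF _ d k R'])
    fix k :: "nat \<Rightarrow> real" and c b assume "\<And>j. j < 3 \<Longrightarrow> 0 \<le> k j" "(c :: real) > 0" "(b :: real) > 0"
    then show "realizable (admittance_fun (gram k (\<lambda>j p. elong (T p) (E j))) c b)"
      by (intro realizable_tree[OF _ _ _ dual tree]) (auto simp: P_def pos_def E_def three_def)
  qed
qed

section \<open>A network for each alternative of the shape\<close>

lemma det3_perm:
  assumes abc: "distinct [a, b, c :: 3]" and sym: "\<And>p q. R p q = R q p"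
  shows "det3 R = R a a * R b b * R c c + 2 * R a b * R a c * R b c
    - R a a * (R b c)\<^sup>2 - R b b * (R a c)\<^sup>2 - R c c * (R a b)\<^sup>2"
  unfolding det3_def using exhaust_3[of a] exhaust_3[of b] exhaust_3[of c] abc
  by (elim disjE) (simp_all add: sym[of 2 1] sym[of 3 1] sym[of 3 2] algebra_simps power2_eq_square)

text \<open>One spring spans \<open>a\<close> and \<open>c\<close>, one spans \<open>c\<close> and
  \<open>b\<close>, and one lies across \<open>c\<close> alone. Where the coupling with
  \<open>c\<close> is zero, the spring lies across \<open>a\<close> or \<open>b\<close>
  alone.\<close>

lemma realizable_zero_entry:
  assumes abc: "distinct [a, b, c :: 3]" and R: "nonneg_minors R" and 0: "R a b = 0"
  shows "realizable (admittance_fun R 1 1)"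
proof -
  have sym: "R p q = R q p" and nn: "0 \<le> R p p" and m2: "(R p q)\<^sup>2 \<le> R p p * R q q" for p q
    using R unfolding nonneg_minors_def by blast+
  have det: "0 \<le> R a a * R b b * R c c - R a a * (R b c)\<^sup>2 - R b b * (R a c)\<^sup>2"
    using R det3_perm[OF abc sym] 0 unfolding nonneg_minors_def by simp
  have z: "R p q = 0" if "R p p = 0" for p q using m2[of p q] that by simp
  \<comment> \<open>A spring across both ports needs equal entries at \<open>(a, a)\<close> and
    \<open>(a, c)\<close>; likewise for \<open>b\<close>.\<close>
  define da where "da = (if R a c = 0 then 1 else R a c / R a a)"
  define db where "db = (if R b c = 0 then 1 else R b c / R b b)"
  define ka where "ka = (if R a c = 0 then R a a else (R a c)\<^sup>2 / R a a)"
  define kb where "kb = (if R b c = 0 then R b b else (R b c)\<^sup>2 / R b b)"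
  \<comment> \<open>A Schur complement at \<open>c\<close>. If a denominator is zero, so is its
    numerator, and the quotient \<open>0\<close> is the right value.\<close>
  define kc where "kc = R c c - (R a c)\<^sup>2 / R a a - (R b c)\<^sup>2 / R b b"
  define ea where "ea = (if R a c = 0 then (1, 0) else (2 :: nat, 0 :: nat))"
  define eb where "eb = (if R b c = 0 then (3, 2) else (3 :: nat, 1 :: nat))"
  have "0 \<le> kc"
  proof -
    consider "R a a = 0" "R b b = 0" | "R a a = 0" "0 < R b b" | "0 < R a a" "R b b = 0" | "0 < R a a" "0 < R b b"
      using nn[of a] nn[of b] by linarith
    then show ?thesis
    proof cases
      case 1
      then show ?thesis unfolding kc_def using nn by simp
    next
      case 2
      then show ?thesis unfolding kc_def using m2[of b c] by (simp add: field_simps)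
    next
      case 3
      then show ?thesis unfolding kc_def using m2[of a c] by (simp add: field_simps)
    next
      case 4
      then have "kc = (R a a * R b b * R c c - R a a * (R b c)\<^sup>2 - R b b * (R a c)\<^sup>2) / (R a a * R b b)"
        unfolding kc_def by (simp add: field_simps)
      then show ?thesis using det 4 by simp
    qed
  qed
  moreover have "da \<noteq> 0" "db \<noteq> 0" "0 \<le> ka" "0 \<le> kb"
    using z[of a c] z[of b c] nn unfolding da_def db_def ka_def kb_def by auto
  moreover have "{ea, eb, (2, 1)} \<subseteq> {(1, 0), (2, 1), (3, 2), (2, 0), (3, 1), (3, 0)}"
    unfolding ea_def eb_def by simp
  ultimately show ?thesis
    using z[of a c] z[of b c]
    by (intro realizable_path[where a = a and b = b and c = c and R = R and da = da and db = db and dc = 1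
          and k\<^sub>0 = ka and k\<^sub>1 = kb and k\<^sub>2 = kc and e\<^sub>0 = ea and e\<^sub>1 = eb and e\<^sub>2 = "(2, 1)", OF abc sym])
      (auto simp: threshold_def da_def db_def ka_def kb_def kc_def ea_def eb_def 0 sym[of c b] power2_eq_square)
qed

lemma ex_third: "p \<noteq> q \<Longrightarrow> \<exists>r::3. distinct [p, q, r]"
  unfolding exists_3 using exhaust_3[of p] exhaust_3[of q] by auto

text \<open>A zero on the diagonal forces zeros off the diagonal in its row.\<close>

lemma realizable_zero:
  assumes R: "nonneg_minors R" and 0: "R p q = 0"
  shows "realizable (admittance_fun R 1 1)"
proof -
  have m2: "(R p q)\<^sup>2 \<le> R p p * R q q" for p q
    using R unfolding nonneg_minors_def by blast
  have off: "realizable (admittance_fun R 1 1)" if pq: "p \<noteq> q" "R p q = 0" for p q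
  proof -
    obtain r where "distinct [p, q, r]"
      using ex_third[OF pq(1)] by blast
    then show ?thesis using realizable_zero_entry R pq(2) by blast
  qed
  show ?thesis
  proof (cases "p = q")
    case True
    obtain r where "r \<noteq> p" using exists_3[of "\<lambda>r. r \<noteq> p"] by (cases "p = 1") auto
    then show ?thesis using off[of p r] m2[of p r] 0 True by simp
  qed (use off 0 in blast)
qed

text \<open>Scaling makes all off-diagonal entries equal to \<open>R a a\<close>. A spring across
  the whole path accounts for them, and springs across \<open>b\<close> and \<open>c\<close> supply
  the rest of the diagonal.\<close>

lemma realizable_zero_minor:
  assumes abc: "distinct [a, b, c :: 3]" and R: "nonneg_minors R" and nz: "\<And>p q. R p q \<noteq> 0"
    and 0: "R a a * R b c = R a b * R a c"
  shows "realizable (admittance_fun R 1 1)"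
proof -
  have sym: "R p q = R q p" and nn: "0 \<le> R p p" and m2: "(R p q)\<^sup>2 \<le> R p p * R q q" for p q
    using R unfolding nonneg_minors_def by blast+
  define db where "db = R a a / R a b"
  define dc where "dc = R a a / R a c"
  have "0 \<le> db * db * R b b - R a a" "0 \<le> dc * dc * R c c - R a a"
  proof -
    have *: "0 \<le> (R a a / R a p) * (R a a / R a p) * R p p - R a a" for p
    proof -
      have "(R a a / R a p) * (R a a / R a p) * R p p - R a a = R a a * (R a a * R p p - (R a p)\<^sup>2) / (R a p)\<^sup>2"
        using nz[of a p] by (simp add: field_simps power2_eq_square)
      also have "\<dots> \<ge> 0" using nn[of a] m2[of a p] by simp
      finally show ?thesis .
    qed
    show "0 \<le> db * db * R b b - R a a" "0 \<le> dc * dc * R c c - R a a"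
      unfolding db_def dc_def by (rule *)+
  qed
  moreover have "dc * db * R c b = R a a"
  proof -
    have "dc * db * R c b = R a a * (R a a * R b c) / (R a b * R a c)"
      unfolding db_def dc_def sym[of c b] by (simp add: mult_ac)
    then show ?thesis unfolding 0 using nz[of a b] nz[of a c] by simp
  qed
  moreover have "dc * R a c = R a a" "db * R a b = R a a" "db \<noteq> 0" "dc \<noteq> 0"
    unfolding db_def dc_def using nz by simp_all
  ultimately show ?thesis
    by (intro realizable_path[where a = a and b = b and c = c and R = R and da = 1 and db = db and dc = dc
          and k\<^sub>0 = "R a a" and k\<^sub>1 = "db * db * R b b - R a a" and k\<^sub>2 = "dc * dc * R c c - R a a"
          and e\<^sub>0 = "(3, 0)" and e\<^sub>1 = "(3, 2)" and e\<^sub>2 = "(2, 1)", OF abc sym])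
      (simp_all add: threshold_def nn)
qed

text \<open>By Sylvester's determinant identity \<open>R a a * det3 R\<close> becomes minus the
  square of a mixed minor, which must therefore vanish too.\<close>

lemma realizable_zero_principal_minor:
  assumes abc: "distinct [a, b, c :: 3]" and R: "nonneg_minors R" and nz: "\<And>p q. R p q \<noteq> 0"
    and 0: "R a a * R b b = (R a b)\<^sup>2"
  shows "realizable (admittance_fun R 1 1)"
proof -
  have sym: "R p q = R q p" and nn: "0 \<le> R p p" for p q
    using R unfolding nonneg_minors_def by blast+
  have "R a a * det3 R = (R a a * R b b - (R a b)\<^sup>2) * (R a a * R c c - (R a c)\<^sup>2) - (R a a * R b c - R a b * R a c)\<^sup>2"
    unfolding det3_perm[OF abc sym] by (simp add: algebra_simps power2_eq_square)
  also have "\<dots> = - (R a a * R b c - R a b * R a c)\<^sup>2" unfolding 0 by simp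
  finally have "(R a a * R b c - R a b * R a c)\<^sup>2 \<le> 0"
    using mult_nonneg_nonneg[OF nn[of a], of "det3 R"] R unfolding nonneg_minors_def by linarith
  then have "R a a * R b c = R a b * R a c" by simp
  then show ?thesis by (rule realizable_zero_minor[OF abc R nz])
qed

text \<open>Scaling the singular matrix by a kernel vector gives zero row sums, and the negative
  product makes all scaled off-diagonal entries negative, as for a triangle.\<close>

lemma realizable_neg:
  assumes R: "nonneg_minors R" and neg: "R 1 2 * R 1 3 * R 2 3 < 0" and det: "det3 R = 0"
  shows "realizable (admittance_fun R 1 1)"
proof -
  have sym: "R p q = R q p" and nn: "0 \<le> R p p" and m2: "(R p q)\<^sup>2 \<le> R p p * R q q" for p q
    using R unfolding nonneg_minors_def by blast+
  have nz: "R 1 2 \<noteq> 0" "R 1 3 \<noteq> 0" "R 2 3 \<noteq> 0" using neg by auto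
  \<comment> \<open>The first column of the adjugate of \<open>R\<close> spans its kernel.\<close>
  define d where "d p = (if p = 1 then R 2 2 * R 3 3 - (R 2 3)\<^sup>2 else if p = 2 then R 1 3 * R 2 3 - R 1 2 * R 3 3
    else R 1 2 * R 2 3 - R 1 3 * R 2 2)" for p :: 3
  have d: "d 1 = R 2 2 * R 3 3 - (R 2 3)\<^sup>2" "d 2 = R 1 3 * R 2 3 - R 1 2 * R 3 3" "d 3 = R 1 2 * R 2 3 - R 1 3 * R 2 2"
    unfolding d_def by simp_all
  note sym' = sym[of 2 1] sym[of 3 1] sym[of 3 2]
  have det': "R 1 1 * R 2 2 * R 3 3 + 2 * R 1 2 * R 1 3 * R 2 3 - R 1 1 * (R 2 3)\<^sup>2 - R 2 2 * (R 1 3)\<^sup>2 - R 3 3 * (R 1 2)\<^sup>2 = 0"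
    using det det3_perm[of 1 2 3 R, OF _ sym] by simp
  have row: "R p 1 * d 1 + R p 2 * d 2 + R p 3 * d 3 = 0" for p
  proof -
    have "\<forall>p. R p 1 * d 1 + R p 2 * d 2 + R p 3 * d 3 = 0"
      unfolding forall_3 d sym' using det' by (simp add: algebra_simps power2_eq_square)
    then show ?thesis by blast
  qed
  have s2: "d 2 * R 1 2 < 0"
  proof -
    have "d 2 * R 1 2 = R 1 2 * R 1 3 * R 2 3 - R 3 3 * (R 1 2)\<^sup>2"
      unfolding d by (simp add: algebra_simps power2_eq_square)
    then show ?thesis using neg mult_nonneg_nonneg[OF nn[of 3] zero_le_power2[of "R 1 2"]] by linarith
  qed
  have s3: "d 3 * R 1 3 < 0"
  proof -
    have "d 3 * R 1 3 = R 1 2 * R 1 3 * R 2 3 - R 2 2 * (R 1 3)\<^sup>2"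
      unfolding d by (simp add: algebra_simps power2_eq_square)
    then show ?thesis using neg mult_nonneg_nonneg[OF nn[of 2] zero_le_power2[of "R 1 3"]] by linarith
  qed
  have d1: "0 < d 1"
  proof -
    have "0 \<le> d 1" unfolding d using m2[of 2 3] by simp
    moreover have "d 1 \<noteq> 0"
    proof
      assume "d 1 = 0"
      \<comment> \<open>Minors of order two of the adjugate are multiples of the determinant, so
        \<open>d 1 = 0\<close> would force \<open>d 3 = 0\<close>.\<close>
      moreover have "d 1 * (R 1 1 * R 2 2 - (R 1 2)\<^sup>2) - (d 3)\<^sup>2 = R 2 2 * (R 1 1 * R 2 2 * R 3 3 + 2 * R 1 2 * R 1 3 * R 2 3 -
          R 1 1 * (R 2 3)\<^sup>2 - R 2 2 * (R 1 3)\<^sup>2 - R 3 3 * (R 1 2)\<^sup>2)"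
        unfolding d by (simp add: algebra_simps power2_eq_square)
      ultimately have "d 3 = 0" unfolding det' by simp
      then show False using s3 by simp
    qed
    ultimately show ?thesis by simp
  qed
  have n23: "d 2 * d 3 * R 2 3 < 0"
  proof -
    have "(d 2 * d 3 * R 2 3) * (R 1 2 * R 1 3)\<^sup>2 = (d 2 * R 1 2) * (d 3 * R 1 3) * (R 1 2 * R 1 3 * R 2 3)"
      by (simp add: power2_eq_square)
    also have "\<dots> < 0" using mult_neg_neg[OF s2 s3] neg by (rule mult_pos_neg)
    finally show ?thesis using zero_le_power2[of "R 1 2 * R 1 3"]
      by (metis linorder_not_less mult_nonneg_nonneg)
  qed
  show ?thesis
  proof (rule realizable_triangle[OF sym _ _ _ _ row])
    show "d p \<noteq> 0" for p
      using exhaust_3[of p] d1 s2 s3 by auto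
    show "d 1 * d 2 * R 1 2 \<le> 0"
      using mult_pos_neg[OF d1 s2] by (simp add: mult.assoc)
    show "d 1 * d 3 * R 1 3 \<le> 0"
      using mult_pos_neg[OF d1 s3] by (simp add: mult.assoc)
    show "d 2 * d 3 * R 2 3 \<le> 0" using n23 by simp
  qed
qed

text \<open>The springs span \<open>a\<close> and \<open>c\<close>, the whole path, and
  \<open>c\<close> and \<open>b\<close>. The relation is what makes the diagonal entry at
  \<open>c\<close> equal to their sum \<open>ka + kb - t\<close>.\<close>

lemma realizable_pos:
  assumes abc: "distinct [a, b, c :: 3]" and R: "nonneg_minors R" and nz: "\<And>p q. R p q \<noteq> 0"
    and pos: "R 1 2 * R 1 3 * R 2 3 > 0"
    and eq: "R a a * R b b * R c c + R a b * R a c * R b c = R a a * (R b c)\<^sup>2 + R b b * (R a c)\<^sup>2"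
  shows "realizable (admittance_fun R 1 1)"
proof -
  have sym: "R p q = R q p" and nn: "0 \<le> R p p" and m2: "(R p q)\<^sup>2 \<le> R p p * R q q" for p q
    using R unfolding nonneg_minors_def by blast+
  have "R a b * R a c * R b c = R 1 2 * R 1 3 * R 2 3"
    using exhaust_3[of a] exhaust_3[of b] exhaust_3[of c] abc
    by (elim disjE) (simp_all add: sym[of 2 1] sym[of 3 1] sym[of 3 2])
  with pos have pos': "R a b * R a c * R b c > 0" by simp
  have p: "0 < R p p" for p using nn[of p] nz[of p p] by simp
  define da where "da = R a c / R a a"
  define db where "db = R b c / R b b"
  define t where "t = R a b * R a c * R b c / (R a a * R b b)"
  define ka where "ka = (R a c)\<^sup>2 / R a a"
  define kb where "kb = (R b c)\<^sup>2 / R b b"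
  have t: "0 < t" unfolding t_def using pos' p by simp
  have cc: "R c c = ka + kb - t"
  proof -
    have "R a a * R b b * (ka + kb - t) = R a a * (R b c)\<^sup>2 + R b b * (R a c)\<^sup>2 - R a b * R a c * R b c"
      unfolding ka_def kb_def t_def using p[of a] p[of b] by (simp add: field_simps)
    also have "\<dots> = R a a * R b b * R c c" using eq by simp
    finally show ?thesis using p[of a] p[of b] by simp
  qed
  have "ka \<le> R c c" "kb \<le> R c c"
    unfolding ka_def kb_def using m2[of a c] m2[of b c] p[of a] p[of b] by (simp_all add: field_simps)
  \<comment> \<open>The two constants are \<open>R c c - kb\<close> and
    \<open>R c c - ka\<close>.\<close>
  then have nonneg: "0 \<le> ka - t" "0 \<le> kb - t" unfolding cc by simp_all
  have "da * da * R a a = ka" "db * db * R b b = kb" "da * R a c = ka" "db * R c b = kb" "da * db * R a b = t"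
    unfolding da_def db_def ka_def kb_def t_def sym[of c b] using p[of a] p[of b]
    by (simp_all add: power2_eq_square mult_ac)
  moreover have "da \<noteq> 0" "db \<noteq> 0" unfolding da_def db_def using nz by simp_all
  ultimately show ?thesis
    using nonneg t
    by (intro realizable_path[where a = a and b = b and c = c and R = R and da = da and db = db and dc = 1
          and k\<^sub>0 = "ka - t" and k\<^sub>1 = t and k\<^sub>2 = "kb - t"
          and e\<^sub>0 = "(2, 0)" and e\<^sub>1 = "(3, 0)" and e\<^sub>2 = "(3, 1)", OF abc sym])
      (simp_all add: threshold_def cc)
qed

lemma realizable_if_shape:
  assumes R: "nonneg_minors R" and shape: "three_spring_shape R"
  shows "realizable (admittance_fun R 1 1)"
proof (cases "\<exists>p q. R p q = 0")
  case True
  then show ?thesis using realizable_zero[OF R] by blast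
next
  case False
  then have nz: "R p q \<noteq> 0" for p q by blast
  have sym: "R p q = R q p" for p q using R unfolding nonneg_minors_def by blast
  from shape[unfolded three_spring_shape_def] show ?thesis
  proof (elim disjE exE conjE)
    fix p q r assume pqr: "q \<noteq> p" "r \<noteq> p" and eq: "R p p * R q r = R p q * R p r"
    show ?thesis
    proof (cases "q = r")
      case True
      obtain s where "distinct [p, q, s]" using ex_third[OF pqr(1)[symmetric]] by blast
      then show ?thesis
        using realizable_zero_principal_minor[OF _ R nz] eq True by (simp add: power2_eq_square)
    next
      case False
      then have "distinct [p, q, r]" using pqr by auto
      then show ?thesis using realizable_zero_minor[OF _ R nz eq] by blast
    qed
  qed (use nz realizable_neg[OF R] realizable_pos[OF _ R nz] in blast)+
qed

section \<open>From networks to coefficients\<close>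

lemma nonneg_minors_scale:
  assumes "nonneg_minors G"
  shows "nonneg_minors (\<lambda>p q. d p * d q * G p q)"
proof -
  have sym: "G p q = G q p" and nn: "0 \<le> G p p" and m2: "(G p q)\<^sup>2 \<le> G p p * G q q" for p q
    using assms unfolding nonneg_minors_def by blast+
  have "det3 (\<lambda>p q. d p * d q * G p q) = (d 1 * d 2 * d 3)\<^sup>2 * det3 G"
    unfolding det3_def by (simp add: algebra_simps power2_eq_square)
  then have "0 \<le> det3 (\<lambda>p q. d p * d q * G p q)"
    using assms unfolding nonneg_minors_def by simp
  moreover have "(d p * d q * G p q)\<^sup>2 \<le> d p * d p * G p p * (d q * d q * G q q)" for p q
    using mult_left_mono[OF m2[of p q] zero_le_power2[of "d p * d q"]]
    by (simp add: power2_eq_square mult_ac)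
  moreover have "d p * d q * G p q = d q * d p * G q p" for p q
    using sym[of p q] by simp
  moreover have "0 \<le> d p * d p * G p p" for p using nn[of p] by simp
  ultimately show ?thesis unfolding nonneg_minors_def by blast
qed

text \<open>The real matrix \<open>L\<close> of the springs has the shape, and scaling by the
  inverse square roots of \<open>c\<close> and \<open>b\<close> reduces to unit damper and
  inerter.\<close>

lemma realization_shape:
  assumes wf: "wf_network N" and d: "dampers N = {d}" and i: "inerters N = {i}" and card: "card (springs N) \<le> 3"
    and X: "X_well_defined N d i" and Y: "driving_point_admittance N Y"
  obtains R where "nonneg_minors R" "three_spring_shape R" "Y = admittance_fun R 1 1"
proof -
  let ?G = "net_graph N"
  interpret G: fin_digraph ?G using wf unfolding wf_network_def by blast
  have di: "d \<in> arcs ?G" "i \<in> arcs ?G" using d i unfolding dampers_def inerters_def by blast+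
  obtain c b where el: "element_of N d = Damper c" "element_of N i = Inerter b"
    using d i unfolding dampers_def inerters_def by blast
  have cb: "c > 0" "b > 0"
    using wf di el unfolding wf_network_def by (metis element_value.simps)+
  obtain A where A: "has_admittance (spring_graph N) (\<lambda>e. element_admittance (element_of N e)) (X_ports N d i) A"
    using X unfolding X_well_defined_def by blast
  have arcs: "arcs (spring_graph N) = springs N" by (simp add: spring_graph_def)
  define k where "k e = element_value (element_of N e)" for e
  have k: "element_admittance (element_of N e) = emb (k e) / svar" "0 < k e" if "e \<in> springs N" for e
    using that wf unfolding springs_def k_def wf_network_def
    by (auto simp: element_admittance_emb simp del: element_admittance.simps)
  interpret X: ported_network "spring_graph N" "X_ports N d i"
    using wf di by unfold_locales
      (auto simp: X_ports_def spring_graph_def springs_def wf_network_def arc_to_ends_def)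
  have "has_admittance (spring_graph N) (\<lambda>e. emb (k e) / svar) (X_ports N d i) A"
    using A has_admittance_cong[where G = "spring_graph N" and P = "X_ports N d i" and A = A and
        y = "\<lambda>e. element_admittance (element_of N e)" and y' = "\<lambda>e. emb (k e) / svar"] k(1)
    unfolding arcs by blast
  then obtain L v where L: "\<And>p q. A $ p $ q = emb (L p q) / svar"
    and v: "\<And>q r. elong (v q) (X_ports N d i r) = (if r = q then 1 else 0 :: real)"
    and power: "\<And>w q. virtual_power (spring_graph N) k (X_ports N d i) (v q) (\<lambda>p. L p q) w"
    using X.spring_admittance_real by metis
  have fin: "finite (springs N)" unfolding springs_def by simp
  obtain g where g: "bij_betw g {..<card (springs N)} (springs N)"
    using ex_bij_betw_nat_finite[OF fin] by (auto simp: atLeast0LessThan)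
  \<comment> \<open>Missing springs are represented by loops, whose elongation is always \<open>0\<close>.\<close>
  define E where "E j = (if j < card (springs N) then arc_to_ends (spring_graph N) (g j) else (undefined, undefined))" for j
  \<comment> \<open>The value \<open>1\<close> keeps the constants of the padding loops positive;
    they contribute no power.\<close>
  define k' where "k' j = (if j < card (springs N) then k (g j) else 1)" for j
  have "nonneg_minors L \<and> three_spring_shape L"
  proof (rule spring_matrix_shape[OF _ v])
    show "0 < k' j" for j
      unfolding k'_def using k(2) bij_betwE[OF g] by auto
    fix w q
    have "(\<Sum>j<3. k' j * elong (v q) (E j) * elong w (E j)) =
        (\<Sum>j<card (springs N). k' j * elong (v q) (E j) * elong w (E j))"
      by (rule sum.mono_neutral_right) (use card in \<open>auto simp: E_def elong_def\<close>)
    also have "\<dots> = (\<Sum>j<card (springs N). k (g j) * elong (v q) (arc_to_ends (spring_graph N) (g j)) *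
        elong w (arc_to_ends (spring_graph N) (g j)))"
      by (rule sum.cong) (simp_all add: E_def k'_def)
    also have "\<dots> = (\<Sum>e\<in>springs N. k e * elong (v q) (arc_to_ends (spring_graph N) e) * elong w (arc_to_ends (spring_graph N) e))"
      by (rule sum.reindex_bij_betw[OF g])
    also have "\<dots> = (\<Sum>p\<in>UNIV. L p q * elong w (X_ports N d i p))"
      using power[of q w] unfolding virtual_power_def arcs .
    finally show "(\<Sum>j<3. k' j * elong (v q) (E j) * elong w (E j)) = (\<Sum>p\<in>UNIV. L p q * elong w (X_ports N d i p))" .
  qed
  then have L': "nonneg_minors L" "three_spring_shape L" by blast+
  then have "L p q = L q p" for p q unfolding nonneg_minors_def by blast
  then have Y': "Y = admittance_fun L c b"
    using driving_point_admittance_iff[OF wf d i el A L] Y by blast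
  define s where "s p = (if p = 1 then 1 else if p = 2 then sqrt c else sqrt b)" for p :: 3
  have s: "s 1 = 1" "(s 2)\<^sup>2 = c" "(s 3)\<^sup>2 = b" "s p \<noteq> 0" for p
    unfolding s_def using cb by simp_all
  define R where "R p q = (1 / s p) * (1 / s q) * L p q" for p q
  have "nonneg_minors R" "three_spring_shape R"
    unfolding R_def using nonneg_minors_scale[OF L'(1), of "\<lambda>p. 1 / s p"] three_spring_shape_scale[OF L'(2), of "\<lambda>p. 1 / s p"] s(4)
    by simp_all
  moreover have "L = (\<lambda>p q. s p * s q * R p q)"
    unfolding R_def using s(4) by (intro ext) simp
  then have "Y = admittance_fun R 1 1"
    using admittance_fun_scale[of s R] s unfolding Y' by simp
  ultimately show ?thesis by (rule that)
qed

theorem theorem5: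
  fixes Y :: ratfun
  assumes "positive_real Y"
  shows
    "(\<exists>(N :: (nat, nat) mech_network) d i.
        wf_network N \<and> dampers N = {d} \<and> inerters N = {i} \<and> card (springs N) \<le> 3 \<and>
        X_well_defined N d i \<and> driving_point_admittance N Y)
     \<longleftrightarrow>
     (\<exists>(\<alpha>\<^sub>0 :: real) (\<alpha>\<^sub>1 :: real) (\<alpha>\<^sub>2 :: real) (\<alpha>\<^sub>3 :: real) (\<beta>\<^sub>1 :: real) (\<beta>\<^sub>2 :: real) (\<beta>\<^sub>3 :: real).
        Y = Fract [:\<alpha>\<^sub>0, \<alpha>\<^sub>1, \<alpha>\<^sub>2, \<alpha>\<^sub>3:] [:0, \<beta>\<^sub>1, \<beta>\<^sub>2, \<beta>\<^sub>3, 1:] \<and>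
        \<alpha>\<^sub>0 \<ge> 0 \<and> \<alpha>\<^sub>1 \<ge> 0 \<and> \<alpha>\<^sub>2 \<ge> 0 \<and> \<alpha>\<^sub>3 \<ge> 0 \<and> \<beta>\<^sub>1 \<ge> 0 \<and> \<beta>\<^sub>2 \<ge> 0 \<and> \<beta>\<^sub>3 \<ge> 0 \<and>
        (let W\<^sub>1 = \<alpha>\<^sub>3 * \<beta>\<^sub>3 - \<alpha>\<^sub>2;
             W\<^sub>2 = \<alpha>\<^sub>3 * \<beta>\<^sub>2 - \<alpha>\<^sub>1;
             W\<^sub>3 = \<beta>\<^sub>2 * \<beta>\<^sub>3 - \<beta>\<^sub>1;
             W = \<alpha>\<^sub>0 + 2 * \<alpha>\<^sub>3 * \<beta>\<^sub>2 * \<beta>\<^sub>3 - \<alpha>\<^sub>3 * \<beta>\<^sub>1 - \<alpha>\<^sub>2 * \<beta>\<^sub>2 - \<alpha>\<^sub>1 * \<beta>\<^sub>3;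
             condition1 =
               (\<alpha>\<^sub>1 = 0 \<or> \<alpha>\<^sub>2 = 0 \<or> \<alpha>\<^sub>3 = 0 \<or> \<beta>\<^sub>1 = 0 \<or> \<beta>\<^sub>2 = 0 \<or> \<beta>\<^sub>3 = 0 \<or>
                W\<^sub>1 = 0 \<or> W\<^sub>2 = 0 \<or> W\<^sub>3 = 0 \<or>
                \<beta>\<^sub>2 - W / (2 * W\<^sub>1) = 0 \<or> \<beta>\<^sub>3 - W / (2 * W\<^sub>2) = 0 \<or> \<alpha>\<^sub>3 - W / (2 * W\<^sub>3) = 0)
         in W\<^sub>1 \<ge> 0 \<and> W\<^sub>2 \<ge> 0 \<and> W\<^sub>3 \<ge> 0 \<and> W\<^sup>2 = 4 * W\<^sub>1 * W\<^sub>2 * W\<^sub>3 \<and>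
            (condition1 \<or>
             \<not> condition1 \<and>
               (W < 0 \<and> \<alpha>\<^sub>0 = 0 \<or>
                W > 0 \<and> \<alpha>\<^sub>0 + \<alpha>\<^sub>3 * \<beta>\<^sub>1 + \<alpha>\<^sub>2 * \<beta>\<^sub>2 - \<alpha>\<^sub>1 * \<beta>\<^sub>3 = 0 \<or>
                W > 0 \<and> \<alpha>\<^sub>0 + \<alpha>\<^sub>3 * \<beta>\<^sub>1 + \<alpha>\<^sub>1 * \<beta>\<^sub>3 - \<alpha>\<^sub>2 * \<beta>\<^sub>2 = 0 \<or>
                W > 0 \<and> \<alpha>\<^sub>0 + \<alpha>\<^sub>1 * \<beta>\<^sub>3 + \<alpha>\<^sub>2 * \<beta>\<^sub>2 - \<alpha>\<^sub>3 * \<beta>\<^sub>1 = 0))))"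
proof -
  have "(\<exists>(N :: (nat, nat) mech_network) d i.
        wf_network N \<and> dampers N = {d} \<and> inerters N = {i} \<and> card (springs N) \<le> 3 \<and>
        X_well_defined N d i \<and> driving_point_admittance N Y) \<longleftrightarrow>
      (\<exists>R. nonneg_minors R \<and> three_spring_shape R \<and> Y = admittance_fun R 1 1)"
    using realization_shape realizable_if_shape unfolding realizable_def by metis
  \<comment> \<open>With unit damper and inerter the denominator is monic, so the coefficients can
    be read off from \<open>R\<close>.\<close>
  also have "\<dots> \<longleftrightarrow> (\<exists>\<alpha>\<^sub>0 \<alpha>\<^sub>1 \<alpha>\<^sub>2 \<alpha>\<^sub>3 \<beta>\<^sub>1 \<beta>\<^sub>2 \<beta>\<^sub>3.
      Y = Fract [:\<alpha>\<^sub>0, \<alpha>\<^sub>1, \<alpha>\<^sub>2, \<alpha>\<^sub>3:] [:0, \<beta>\<^sub>1, \<beta>\<^sub>2, \<beta>\<^sub>3, 1:] \<and>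
      coefficient_condition \<alpha>\<^sub>0 \<alpha>\<^sub>1 \<alpha>\<^sub>2 \<alpha>\<^sub>3 \<beta>\<^sub>1 \<beta>\<^sub>2 \<beta>\<^sub>3)"
    unfolding coefficient_condition_iff admittance_fun_def mult_1 by blast
  finally show ?thesis unfolding coefficient_condition_def .
qed

end
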